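(* Let $\mathcal{G}$ be a (non-empty) finite groupoid and let $\mathcal{G}\cong\coprod_{i=1}^n\mathcal{G}_{[i]}$ be the decomposition of $\mathcal{G}$ into its connected components. Then the rings $B^c(\mathcal{G})$ and $\prod_{x\in\pi_0(\mathcal{G})}B^c(\mathcal{G}_x)$ are isomorphic, where the product runs over a set of objects $x$ containing exactly one representative of each connected component of $\mathcal{G}$, and $\mathcal{G}_x=\mathcal{G}(x,x)$ is the isotropy group at $x$, regarded as a one-object groupoid.
   Context: A groupoid is a category in which every morphism is invertible; it is finite if it has finitely many objects and morphisms (the empty groupoid is excluded). $\mathcal{G}_0$ is the set of objects, $\mathcal{G}(x,y)$ the set of morphisms from $x$ to $y$. Composition $g\circ g'$ is written $gg'$. For $x,y\in\mathcal{G}_0$ write $x\sim y$ if there is a morphism $x\to y$; $\pi_0(\mathcal{G})=\mathcal{G}_0/{\sim}$ is the set of connected components, and $\mathcal{G}$ is connected if $|\pi_0(\mathcal{G})|=1$. A finite group is identified with the associated one-object groupoid. $\mathbf{set}$ is the category of finite sets and $\mathbf{mon}$ the category of finite monoids. $\mathbf{set}^{\mathcal{G}}$ is the category of functors $\mathcal{G}\to\mathbf{set}$ ($\mathcal{G}$-sets) and natural transformations ($\mathcal{G}$-maps). A $\mathcal{G}$-monoid is a functor $S:\mathcal{G}\to\mathbf{mon}$; $\overline{S}$ denotes its underlying $\mathcal{G}$-set (composite with the forgetful functor $\mathbf{mon}\to\mathbf{set}$). For a $\mathcal{G}$-monoid $S$, the slice category $\mathbf{set}^{\mathcal{G}}/\overline{S}$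 is monoidal with $(\theta:X\to\overline{S})\otimes(\tau:Y\to\overline{S}):=(\theta\otimes\tau:X\times Y\to\overline{S})$, where $(\theta\otimes\tau)_G(x,y)=\theta_G(x)\tau_G(y)$ for $G\in\mathcal{G}_0$, with unit object $I:1\to\overline{S}$ picking out $1_{S(G)}$ at each $G$, and with the associator and unitors inherited from the cartesian product. The crossed Burnside ring $B^c(\mathcal{G},S)$ is the Grothendieck ring of $(\mathbf{set}^{\mathcal{G}}/\overline{S},\sqcup,\otimes)$: the group completion of the commutative monoid of isomorphism classes under disjoint union $\sqcup$ (the coproduct), with multiplication induced by $\otimes$. The conjugation action of $\mathcal{G}$ is the $\mathcal{G}$-monoid $\mathcal{G}^c$ with $\mathcal{G}^c(x)=\mathcal{G}_x$ for $x\in\mathcal{G}_0$ and, for $g:x\to y$, $\mathcal{G}^c(g):\mathcal{G}_x\to\mathcal{G}_y$, $h\mapsto ghg^{-1}$. The crossed Burnside ring of $\mathcal{G}$ is $B^c(\mathcal{G}):=B^c(\mathcal{G},\mathcal{G}^c)$. *)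

theory Defs
  imports "HOL-Algebra.QuotRing"
begin

section \<open>Finite groupoids\<close>

record ('o, 'm) cat =
  Obj :: "'o set"
  Arr :: "'m set"
  Src :: "'m \<Rightarrow> 'o"
  Tgt :: "'m \<Rightarrow> 'o"
  Cmp :: "'m \<Rightarrow> 'm \<Rightarrow> 'm"  (* Cmp C g h is "g after h", meaningful when Src g = Tgt h *)
  Idt :: "'o \<Rightarrow> 'm"

definition Hom :: "('o, 'm) cat \<Rightarrow> 'o \<Rightarrow> 'o \<Rightarrow> 'm set" where
  "Hom C x y = {g \<in> Arr C. Src C g = x \<and> Tgt C g = y}"

locale category =
  fixes C :: "('o, 'm) cat"
  assumes Src_closed: "g \<in> Arr C \<Longrightarrow> Src C g \<in> Obj C"
    and Tgt_closed: "g \<in> Arr C \<Longrightarrow> Tgt C g \<in> Obj C"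
    and Idt_closed: "x \<in> Obj C \<Longrightarrow> Idt C x \<in> Hom C x x"
    and Cmp_closed: "g \<in> Hom C y z \<Longrightarrow> h \<in> Hom C x y \<Longrightarrow> Cmp C g h \<in> Hom C x z"
    and Cmp_assoc: "f \<in> Hom C z w \<Longrightarrow> g \<in> Hom C y z \<Longrightarrow> h \<in> Hom C x y \<Longrightarrow>
        Cmp C (Cmp C f g) h = Cmp C f (Cmp C g h)"
    and Cmp_Idt_left: "g \<in> Hom C x y \<Longrightarrow> Cmp C (Idt C y) g = g"
    and Cmp_Idt_right: "g \<in> Hom C x y \<Longrightarrow> Cmp C g (Idt C x) = g"

definition is_inverse :: "('o, 'm) cat \<Rightarrow> 'm \<Rightarrow> 'm \<Rightarrow> bool" where
  "is_inverse C g h \<longleftrightarrow> h \<in> Hom C (Tgt C g) (Src C g) \<and>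
     Cmp C h g = Idt C (Src C g) \<and> Cmp C g h = Idt C (Tgt C g)"

locale groupoid = category C for C :: "('o, 'm) cat" +
  assumes invertible: "g \<in> Arr C \<Longrightarrow> \<exists>h. is_inverse C g h"

locale finite_groupoid = groupoid C for C :: "('o, 'm) cat" +
  assumes finite_Obj: "finite (Obj C)"
    and finite_Arr: "finite (Arr C)"
    and nonempty: "Obj C \<noteq> {}"

definition arr_inv :: "('o, 'm) cat \<Rightarrow> 'm \<Rightarrow> 'm" where
  "arr_inv C g = (THE h. is_inverse C g h)"

definition connected_rel :: "('o, 'm) cat \<Rightarrow> ('o \<times> 'o) set" where
  "connected_rel C = {(x, y). x \<in> Obj C \<and> y \<in> Obj C \<and> Hom C x y \<noteq> {}}"

definition components :: "('o, 'm) cat \<Rightarrow> 'o set set" where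
  "components C = Obj C // connected_rel C"

definition isotropy :: "('o, 'm) cat \<Rightarrow> 'o \<Rightarrow> 'm monoid" where
  "isotropy C x = \<lparr>carrier = Hom C x x, mult = Cmp C, one = Idt C x\<rparr>"

definition one_object :: "'m monoid \<Rightarrow> (unit, 'm) cat" where
  "one_object H = \<lparr>Obj = {()}, Arr = carrier H, Src = (\<lambda>_. ()), Tgt = (\<lambda>_. ()),
     Cmp = mult H, Idt = (\<lambda>_. one H)\<rparr>"


section \<open>Functors to finite sets and to finite monoids\<close>

text \<open>Maps are total functions of which only the restriction to the relevant carrier matters.\<close>

record ('o, 'm, 'a) gset =
  fob :: "'o \<Rightarrow> 'a set"
  fmap :: "'m \<Rightarrow> 'a \<Rightarrow> 'a"

definition is_gset :: "('o, 'm) cat \<Rightarrow> ('o, 'm, 'a, 'e) gset_scheme \<Rightarrow> bool" where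
  "is_gset C X \<longleftrightarrow>
     (\<forall>x\<in>Obj C. finite (fob X x)) \<and>
     (\<forall>g\<in>Arr C. fmap X g \<in> fob X (Src C g) \<rightarrow> fob X (Tgt C g)) \<and>
     (\<forall>x\<in>Obj C. \<forall>a\<in>fob X x. fmap X (Idt C x) a = a) \<and>
     (\<forall>g\<in>Arr C. \<forall>h\<in>Arr C. Src C g = Tgt C h \<longrightarrow>
        (\<forall>a\<in>fob X (Src C h). fmap X (Cmp C g h) a = fmap X g (fmap X h a)))"

definition gmaps :: "('o, 'm) cat \<Rightarrow> ('o, 'm, 'a, 'e) gset_scheme \<Rightarrow> ('o, 'm, 'b, 'f) gset_scheme
    \<Rightarrow> ('o \<Rightarrow> 'a \<Rightarrow> 'b) set" where
  "gmaps C X Y = {\<phi>. (\<forall>x\<in>Obj C. \<phi> x \<in> fob X x \<rightarrow> fob Y x) \<and>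
     (\<forall>g\<in>Arr C. \<forall>a\<in>fob X (Src C g). \<phi> (Tgt C g) (fmap X g a) = fmap Y g (\<phi> (Src C g) a))}"

record ('o, 'm, 's) gmonoid =
  mob :: "'o \<Rightarrow> 's monoid"
  mmap :: "'m \<Rightarrow> 's \<Rightarrow> 's"

definition underlying :: "('o, 'm, 's) gmonoid \<Rightarrow> ('o, 'm, 's) gset" where
  "underlying S = \<lparr>fob = (\<lambda>x. carrier (mob S x)), fmap = mmap S\<rparr>"

text \<open>The library's \<open>hom\<close> does not require units to be preserved, hence the separate condition.\<close>

definition is_gmonoid :: "('o, 'm) cat \<Rightarrow> ('o, 'm, 's) gmonoid \<Rightarrow> bool" where
  "is_gmonoid C S \<longleftrightarrow>
     is_gset C (underlying S) \<and>
     (\<forall>x\<in>Obj C. Group.monoid (mob S x)) \<and>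
     (\<forall>g\<in>Arr C. mmap S g \<in> hom (mob S (Src C g)) (mob S (Tgt C g)) \<and>
        mmap S g (one (mob S (Src C g))) = one (mob S (Tgt C g)))"

definition conj_action :: "('o, 'm) cat \<Rightarrow> ('o, 'm, 'm) gmonoid" where
  "conj_action C = \<lparr>mob = isotropy C, mmap = (\<lambda>g h. Cmp C (Cmp C g h) (arr_inv C g))\<rparr>"


section \<open>The slice category over the underlying set of a monoid-valued functor\<close>

record ('o, 'm, 'a, 's) slice = "('o, 'm, 'a) gset" +
  str :: "'o \<Rightarrow> 'a \<Rightarrow> 's"

definition slice_obj :: "('o, 'm) cat \<Rightarrow> ('o, 'm, 's) gmonoid \<Rightarrow> ('o, 'm, 'a, 's) slice \<Rightarrow> bool" where
  "slice_obj C S X \<longleftrightarrow> is_gset C X \<and> str X \<in> gmaps C X (underlying S)"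

definition slice_hom :: "('o, 'm) cat \<Rightarrow> ('o, 'm, 'a, 's) slice \<Rightarrow> ('o, 'm, 'b, 's) slice
    \<Rightarrow> ('o \<Rightarrow> 'a \<Rightarrow> 'b) set" where
  "slice_hom C X Y = {\<phi> \<in> gmaps C X Y. \<forall>x\<in>Obj C. \<forall>a\<in>fob X x. str Y x (\<phi> x a) = str X x a}"

definition slice_iso :: "('o, 'm) cat \<Rightarrow> ('o, 'm, 'a, 's) slice \<Rightarrow> ('o, 'm, 'b, 's) slice \<Rightarrow> bool" where
  "slice_iso C X Y \<longleftrightarrow> (\<exists>\<phi>\<in>slice_hom C X Y. \<exists>\<psi>\<in>slice_hom C Y X. \<forall>x\<in>Obj C.
     (\<forall>a\<in>fob X x. \<psi> x (\<phi> x a) = a) \<and> (\<forall>b\<in>fob Y x. \<phi> x (\<psi> x b) = b))"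

definition slice_sum :: "('o, 'm, 'a, 's) slice \<Rightarrow> ('o, 'm, 'b, 's) slice
    \<Rightarrow> ('o, 'm, 'a + 'b, 's) slice" where
  "slice_sum X Y = \<lparr>fob = (\<lambda>x. Sum_Type.Plus (fob X x) (fob Y x)),
     fmap = (\<lambda>g. map_sum (fmap X g) (fmap Y g)), str = (\<lambda>x. case_sum (str X x) (str Y x))\<rparr>"

definition slice_empty :: "('o, 'm, 'a, 's) slice" where
  "slice_empty = \<lparr>fob = (\<lambda>_. {}), fmap = (\<lambda>_ a. a), str = (\<lambda>_ _. undefined)\<rparr>"

definition slice_tensor :: "('o, 'm, 's) gmonoid \<Rightarrow> ('o, 'm, 'a, 's) slice \<Rightarrow> ('o, 'm, 'b, 's) slice
    \<Rightarrow> ('o, 'm, 'a \<times> 'b, 's) slice" where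
  "slice_tensor S X Y = \<lparr>fob = (\<lambda>x. fob X x \<times> fob Y x), fmap = (\<lambda>g. map_prod (fmap X g) (fmap Y g)),
     str = (\<lambda>x (a, b). mult (mob S x) (str X x a) (str Y x b))\<rparr>"

definition slice_unit :: "('o, 'm, 's) gmonoid \<Rightarrow> ('o, 'm, unit, 's) slice" where
  "slice_unit S = \<lparr>fob = (\<lambda>_. {()}), fmap = (\<lambda>_ _. ()), str = (\<lambda>x _. one (mob S x))\<rparr>"


section \<open>Isomorphism classes and the Grothendieck ring\<close>

text \<open>
  To have a set of isomorphism classes, a class is represented by its members whose finite sets
  consist of natural numbers; every finite set is in bijection with such a set, so no class is lost.
  The object \<open>X\<close> itself may take values in any type.
\<close>

definition iso_class :: "('o, 'm) cat \<Rightarrow> ('o, 'm, 's) gmonoid \<Rightarrow> ('o, 'm, 'a, 's) slice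
    \<Rightarrow> ('o, 'm, nat, 's) slice set" where
  "iso_class C S X = {Y. slice_obj C S Y \<and> slice_iso C X Y}"

text \<open>
  The semiring of isomorphism classes. The unions below are over representatives and are unions of
  one and the same class.
\<close>

definition iso_semiring :: "('o, 'm) cat \<Rightarrow> ('o, 'm, 's) gmonoid
    \<Rightarrow> ('o, 'm, nat, 's) slice set ring" where
  "iso_semiring C S = \<lparr>
     carrier = {iso_class C S X | X :: ('o, 'm, nat, 's) slice. slice_obj C S X},
     mult = (\<lambda>P Q. \<Union>X\<in>P. \<Union>Y\<in>Q. iso_class C S (slice_tensor S X Y)),
     one = iso_class C S (slice_unit S),
     zero = iso_class C S (slice_empty :: ('o, 'm, nat, 's) slice),
     add = (\<lambda>P Q. \<Union>X\<in>P. \<Union>Y\<in>Q. iso_class C S (slice_sum X Y))\<rparr>"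

definition groth_rel :: "'a ring \<Rightarrow> (('a \<times> 'a) \<times> ('a \<times> 'a)) set" where
  "groth_rel M = {((a, b), (c, d)). a \<in> carrier M \<and> b \<in> carrier M \<and> c \<in> carrier M \<and> d \<in> carrier M \<and>
     (\<exists>k\<in>carrier M. a \<oplus>\<^bsub>M\<^esub> d \<oplus>\<^bsub>M\<^esub> k = c \<oplus>\<^bsub>M\<^esub> b \<oplus>\<^bsub>M\<^esub> k)}"

text \<open>
  Group completion of a semiring, which is given as a ring record whose addition need not have
  inverses. The class of \<open>(a, b)\<close> stands for the formal difference of \<open>a\<close> and \<open>b\<close>.
\<close>

definition grothendieck_ring :: "'a ring \<Rightarrow> ('a \<times> 'a) set ring" where
  "grothendieck_ring M = \<lparr>
     carrier = (carrier M \<times> carrier M) // groth_rel M,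
     mult = (\<lambda>P Q. \<Union>(a, b)\<in>P. \<Union>(c, d)\<in>Q.
       groth_rel M `` {(a \<otimes>\<^bsub>M\<^esub> c \<oplus>\<^bsub>M\<^esub> b \<otimes>\<^bsub>M\<^esub> d, a \<otimes>\<^bsub>M\<^esub> d \<oplus>\<^bsub>M\<^esub> b \<otimes>\<^bsub>M\<^esub> c)}),
     one = groth_rel M `` {(\<one>\<^bsub>M\<^esub>, \<zero>\<^bsub>M\<^esub>)},
     zero = groth_rel M `` {(\<zero>\<^bsub>M\<^esub>, \<zero>\<^bsub>M\<^esub>)},
     add = (\<lambda>P Q. \<Union>(a, b)\<in>P. \<Union>(c, d)\<in>Q. groth_rel M `` {(a \<oplus>\<^bsub>M\<^esub> c, b \<oplus>\<^bsub>M\<^esub> d)})\<rparr>"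

definition crossed_burnside_over :: "('o, 'm) cat \<Rightarrow> ('o, 'm, 's) gmonoid
    \<Rightarrow> (('o, 'm, nat, 's) slice set \<times> ('o, 'm, nat, 's) slice set) set ring" where
  "crossed_burnside_over C S = grothendieck_ring (iso_semiring C S)"

definition crossed_burnside :: "('o, 'm) cat
    \<Rightarrow> (('o, 'm, nat, 'm) slice set \<times> ('o, 'm, nat, 'm) slice set) set ring" where
  "crossed_burnside C = crossed_burnside_over C (conj_action C)"

definition product_ring :: "'i set \<Rightarrow> ('i \<Rightarrow> 'a ring) \<Rightarrow> ('i \<Rightarrow> 'a) ring" where
  "product_ring I R = \<lparr>
     carrier = (\<Pi>\<^sub>E i\<in>I. carrier (R i)),
     mult = (\<lambda>p q. \<lambda>i\<in>I. p i \<otimes>\<^bsub>R i\<^esub> q i),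
     one = (\<lambda>i\<in>I. \<one>\<^bsub>R i\<^esub>),
     zero = (\<lambda>i\<in>I. \<zero>\<^bsub>R i\<^esub>),
     add = (\<lambda>p q. \<lambda>i\<in>I. p i \<oplus>\<^bsub>R i\<^esub> q i)\<rparr>"

end

theory Submission
  imports Defs
begin

text \<open>
  Restricting a slice object \<open>X\<close> over \<open>G\<close> to an object \<open>x\<close> of \<open>G\<close> gives a slice object over the
  isotropy group at \<open>x\<close>. Disjoint unions and tensor products are formed pointwise, so restriction
  respects them strictly and induces a homomorphism between the semirings of isomorphism classes
  (\<open>restrict_class_hom\<close>). Let \<open>R\<close> contain one object of each connected component. The point is that the
  restrictions to the objects of \<open>R\<close> are jointly bijective on isomorphism classes, which is the
  equivalence of \<open>G\<close> with the disjoint union of the isotropy groups at \<open>R\<close> in concrete form. For each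
  object \<open>y\<close> choose an arrow \<open>t y\<close> from the representative \<open>r y\<close> of its component to \<open>y\<close>. Isomorphisms
  of the restrictions are carried from \<open>r y\<close> to \<open>y\<close> along \<open>t y\<close> and fit together to an isomorphism over
  \<open>G\<close> (\<open>slice_iso_if_restrict\<close>); conversely objects over the isotropy groups are pulled back along the
  retraction \<open>g \<mapsto> t(z)\<inverse> g t(y)\<close>, for \<open>g\<close> from \<open>y\<close> to \<open>z\<close>, to one object over \<open>G\<close>
  (\<open>slice_obj_extend\<close>, \<open>restrict_extend_iso\<close>).
  
  Group completion turns such a jointly bijective family of semiring homomorphisms into an isomorphism
  onto the product of the completions (\<open>groth_product_iso\<close>): an equality of formal differences is
  witnessed by one element \<open>k\<close>, and witnesses chosen in the single factors come from a common witness in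
  the source.
  
  This argument works for an arbitrary monoid-valued functor \<open>S\<close> and the functors to which \<open>S\<close> restricts
  on the isotropy groups (\<open>crossed_burnside_over_iso\<close>). For the conjugation action, the restriction at
  \<open>x\<close> agrees with the conjugation action of the isotropy group at \<open>x\<close>
  (\<open>iso_semiring_conj_isotropy\<close>).
\<close>

section \<open>The group completion of a semiring\<close>

definition formal_diff :: "'a ring \<Rightarrow> 'a \<Rightarrow> 'a \<Rightarrow> ('a \<times> 'a) set" where
  "formal_diff M a b = groth_rel M `` {(a, b)}"

locale semiring_completion = semiring M for M :: "'a ring" (structure)
begin

lemma groth_rel_iff:
  assumes "a \<in> carrier M" "b \<in> carrier M" "c \<in> carrier M" "d \<in> carrier M"
  shows "((a, b), (c, d)) \<in> groth_rel M \<longleftrightarrow> (\<exists>k\<in>carrier M. a \<oplus> d \<oplus> k = c \<oplus> b \<oplus> k)"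
  using assms by (simp add: groth_rel_def)

text \<open>
  Addition need not be cancellative, so the middle pair cannot be removed from the sum of the two
  witnessing equations; it is absorbed into the witness instead.
\<close>

lemma groth_rel_trans:
  assumes "((a, b), (c, d)) \<in> groth_rel M" and "((c, d), (e, f)) \<in> groth_rel M"
  shows "((a, b), (e, f)) \<in> groth_rel M"
proof -
  have car: "a \<in> carrier M" "b \<in> carrier M" "c \<in> carrier M" "d \<in> carrier M"
      "e \<in> carrier M" "f \<in> carrier M"
    using assms by (auto simp: groth_rel_def)
  from assms obtain k l where k: "k \<in> carrier M" "a \<oplus> d \<oplus> k = c \<oplus> b \<oplus> k"
    and l: "l \<in> carrier M" "c \<oplus> f \<oplus> l = e \<oplus> d \<oplus> l"
    by (auto simp: groth_rel_def)
  have "a \<oplus> f \<oplus> (c \<oplus> d \<oplus> k \<oplus> l) = (a \<oplus> d \<oplus> k) \<oplus> (c \<oplus> f \<oplus> l)"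
    using car k(1) l(1) by (simp add: a_ac)
  also have "\<dots> = (c \<oplus> b \<oplus> k) \<oplus> (e \<oplus> d \<oplus> l)"
    by (simp only: k(2) l(2))
  also have "\<dots> = e \<oplus> b \<oplus> (c \<oplus> d \<oplus> k \<oplus> l)"
    using car k(1) l(1) by (simp add: a_ac)
  finally have "\<exists>k\<in>carrier M. a \<oplus> f \<oplus> k = e \<oplus> b \<oplus> k"
    using car k(1) l(1) by (intro bexI[of _ "c \<oplus> d \<oplus> k \<oplus> l"]) simp_all
  then show ?thesis using car by (simp add: groth_rel_iff)
qed

lemma equiv_groth_rel: "equiv (carrier M \<times> carrier M) (groth_rel M)"
proof (rule equivI)
  show "groth_rel M \<subseteq> (carrier M \<times> carrier M) \<times> (carrier M \<times> carrier M)"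
    by (auto simp: groth_rel_def)
  show "refl_on (carrier M \<times> carrier M) (groth_rel M)"
    by (auto simp: refl_on_def groth_rel_def)
  show "sym (groth_rel M)"
    by (rule symI) (auto simp: groth_rel_def, metis)
  show "trans (groth_rel M)"
    by (rule transI) (metis groth_rel_trans surj_pair)
qed

lemma formal_diff_eq_iff:
  assumes "a \<in> carrier M" "b \<in> carrier M" "c \<in> carrier M" "d \<in> carrier M"
  shows "formal_diff M a b = formal_diff M c d \<longleftrightarrow>
    (\<exists>k\<in>carrier M. a \<oplus> d \<oplus> k = c \<oplus> b \<oplus> k)"
  using eq_equiv_class_iff[OF equiv_groth_rel, of "(a, b)" "(c, d)"] assms
  by (simp add: formal_diff_def groth_rel_iff)

lemma formal_diff_mem:
  assumes "(c, d) \<in> formal_diff M a b"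
  shows "a \<in> carrier M" "b \<in> carrier M" "c \<in> carrier M" "d \<in> carrier M"
    "formal_diff M c d = formal_diff M a b"
proof -
  show *: "a \<in> carrier M" "b \<in> carrier M" "c \<in> carrier M" "d \<in> carrier M"
    using assms by (auto simp: formal_diff_def groth_rel_def)
  have "((a, b), (c, d)) \<in> groth_rel M"
    using assms by (auto simp: formal_diff_def)
  then show "formal_diff M c d = formal_diff M a b"
    using equiv_class_eq[OF equiv_groth_rel] by (fastforce simp: formal_diff_def)
qed

lemma formal_diff_self:
  assumes "a \<in> carrier M" "b \<in> carrier M"
  shows "(a, b) \<in> formal_diff M a b"
  using assms by (auto simp: formal_diff_def groth_rel_def)

text \<open>
  The operations of the Grothendieck ring are unions over representatives; this evaluates such a union
  once the choice of representative is known not to matter.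
\<close>

lemma formal_diff_UN:
  assumes "a \<in> carrier M" "b \<in> carrier M"
    and "\<And>c d. (c, d) \<in> formal_diff M a b \<Longrightarrow> F c d = K"
  shows "(\<Union>(c, d)\<in>formal_diff M a b. F c d) = K"
proof -
  have "(\<Union>(c, d)\<in>formal_diff M a b. F c d) = (\<Union>p\<in>formal_diff M a b. K)"
    by (rule SUP_cong) (auto simp: assms(3))
  then show ?thesis using formal_diff_self[OF assms(1,2)] by auto
qed

lemma carrier_groth:
  "carrier (grothendieck_ring M) = {formal_diff M a b |a b. a \<in> carrier M \<and> b \<in> carrier M}"
  by (auto simp: grothendieck_ring_def quotient_def formal_diff_def)

lemma grothE:
  assumes "P \<in> carrier (grothendieck_ring M)"
  obtains a b where "a \<in> carrier M" "b \<in> carrier M" "P = formal_diff M a b"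
  using assms by (auto simp: carrier_groth)

lemma add_formal_diff:
  assumes "a \<in> carrier M" "b \<in> carrier M" "c \<in> carrier M" "d \<in> carrier M"
  shows "formal_diff M a b \<oplus>\<^bsub>grothendieck_ring M\<^esub> formal_diff M c d
    = formal_diff M (a \<oplus> c) (b \<oplus> d)"
proof -
  have add_cong: "formal_diff M (a' \<oplus> c') (b' \<oplus> d') = formal_diff M (a \<oplus> c) (b \<oplus> d)"
    if h: "(a', b') \<in> formal_diff M a b" "(c', d') \<in> formal_diff M c d" for a' b' c' d'
  proof -
    note car = formal_diff_mem[OF h(1)] formal_diff_mem[OF h(2)]
    obtain k where k: "k \<in> carrier M" "a' \<oplus> b \<oplus> k = a \<oplus> b' \<oplus> k"
      using car by (auto simp: formal_diff_eq_iff)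
    obtain l where l: "l \<in> carrier M" "c' \<oplus> d \<oplus> l = c \<oplus> d' \<oplus> l"
      using car by (auto simp: formal_diff_eq_iff)
    have "(a' \<oplus> c') \<oplus> (b \<oplus> d) \<oplus> (k \<oplus> l) = (a' \<oplus> b \<oplus> k) \<oplus> (c' \<oplus> d \<oplus> l)"
      using car(1-4,6-9) k(1) l(1) by (simp add: a_ac)
    also have "\<dots> = (a \<oplus> b' \<oplus> k) \<oplus> (c \<oplus> d' \<oplus> l)"
      by (simp only: k(2) l(2))
    also have "\<dots> = (a \<oplus> c) \<oplus> (b' \<oplus> d') \<oplus> (k \<oplus> l)"
      using car(1-4,6-9) k(1) l(1) by (simp add: a_ac)
    finally show ?thesis
      using car(1-4,6-9) k(1) l(1) by (subst formal_diff_eq_iff) auto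
  qed
  show ?thesis
    unfolding grothendieck_ring_def ring.simps formal_diff_def[symmetric]
    by (intro formal_diff_UN assms add_cong)
qed

text \<open>
  If \<open>k\<close> witnesses that \<open>(a', b')\<close> and \<open>(a, b)\<close> are equivalent, multiply its equation by \<open>c\<close> and, read from
  right to left, by \<open>d\<close>, and add the results: this is the equation for the products, with witness
  \<open>k \<otimes> c \<oplus> k \<otimes> d\<close>.
\<close>

lemma mult_respects_left:
  assumes "(a', b') \<in> formal_diff M a b" and cd: "c \<in> carrier M" "d \<in> carrier M"
  shows "formal_diff M (a' \<otimes> c \<oplus> b' \<otimes> d) (a' \<otimes> d \<oplus> b' \<otimes> c)
    = formal_diff M (a \<otimes> c \<oplus> b \<otimes> d) (a \<otimes> d \<oplus> b \<otimes> c)"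
proof -
  note car = formal_diff_mem[OF assms(1)]
  obtain k where k: "k \<in> carrier M" "a' \<oplus> b \<oplus> k = a \<oplus> b' \<oplus> k"
    using car by (auto simp: formal_diff_eq_iff)
  have "(a' \<otimes> c \<oplus> b' \<otimes> d) \<oplus> (a \<otimes> d \<oplus> b \<otimes> c) \<oplus> (k \<otimes> c \<oplus> k \<otimes> d)
      = (a' \<oplus> b \<oplus> k) \<otimes> c \<oplus> (a \<oplus> b' \<oplus> k) \<otimes> d"
    using car(1-4) cd k(1) by (simp add: l_distr a_ac)
  also have "\<dots> = (a \<oplus> b' \<oplus> k) \<otimes> c \<oplus> (a' \<oplus> b \<oplus> k) \<otimes> d"
    by (simp only: k(2))
  also have "\<dots> = (a \<otimes> c \<oplus> b \<otimes> d) \<oplus> (a' \<otimes> d \<oplus> b' \<otimes> c) \<oplus> (k \<otimes> c \<oplus> k \<otimes> d)"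
    using car(1-4) cd k(1) by (simp add: l_distr a_ac)
  finally show ?thesis
    using car(1-4) cd k(1) by (subst formal_diff_eq_iff) auto
qed

lemma mult_respects_right:
  assumes "(c', d') \<in> formal_diff M c d" and ab: "a \<in> carrier M" "b \<in> carrier M"
  shows "formal_diff M (a \<otimes> c' \<oplus> b \<otimes> d') (a \<otimes> d' \<oplus> b \<otimes> c')
    = formal_diff M (a \<otimes> c \<oplus> b \<otimes> d) (a \<otimes> d \<oplus> b \<otimes> c)"
proof -
  note car = formal_diff_mem[OF assms(1)]
  obtain k where k: "k \<in> carrier M" "c' \<oplus> d \<oplus> k = c \<oplus> d' \<oplus> k"
    using car by (auto simp: formal_diff_eq_iff)
  have "(a \<otimes> c' \<oplus> b \<otimes> d') \<oplus> (a \<otimes> d \<oplus> b \<otimes> c) \<oplus> (a \<otimes> k \<oplus> b \<otimes> k)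
      = a \<otimes> (c' \<oplus> d \<oplus> k) \<oplus> b \<otimes> (c \<oplus> d' \<oplus> k)"
    using car(1-4) ab k(1) by (simp add: r_distr a_ac)
  also have "\<dots> = a \<otimes> (c \<oplus> d' \<oplus> k) \<oplus> b \<otimes> (c' \<oplus> d \<oplus> k)"
    by (simp only: k(2))
  also have "\<dots> = (a \<otimes> c \<oplus> b \<otimes> d) \<oplus> (a \<otimes> d' \<oplus> b \<otimes> c') \<oplus> (a \<otimes> k \<oplus> b \<otimes> k)"
    using car(1-4) ab k(1) by (simp add: r_distr a_ac)
  finally show ?thesis
    using car(1-4) ab k(1) by (subst formal_diff_eq_iff) auto
qed

lemma mult_formal_diff:
  assumes "a \<in> carrier M" "b \<in> carrier M" "c \<in> carrier M" "d \<in> carrier M"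
  shows "formal_diff M a b \<otimes>\<^bsub>grothendieck_ring M\<^esub> formal_diff M c d
    = formal_diff M (a \<otimes> c \<oplus> b \<otimes> d) (a \<otimes> d \<oplus> b \<otimes> c)"
proof -
  have mult_cong: "formal_diff M (a' \<otimes> c' \<oplus> b' \<otimes> d') (a' \<otimes> d' \<oplus> b' \<otimes> c')
      = formal_diff M (a \<otimes> c \<oplus> b \<otimes> d) (a \<otimes> d \<oplus> b \<otimes> c)"
    if h: "(a', b') \<in> formal_diff M a b" "(c', d') \<in> formal_diff M c d" for a' b' c' d'
    using mult_respects_left[OF h(1) formal_diff_mem(3,4)[OF h(2)]]
      mult_respects_right[OF h(2) assms(1,2)]
    by (rule trans)
  show ?thesis
    unfolding grothendieck_ring_def monoid.simps formal_diff_def[symmetric]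
    by (intro formal_diff_UN assms mult_cong)
qed

lemma zero_groth: "\<zero>\<^bsub>grothendieck_ring M\<^esub> = formal_diff M \<zero> \<zero>"
  and one_groth: "\<one>\<^bsub>grothendieck_ring M\<^esub> = formal_diff M \<one> \<zero>"
  by (simp_all add: grothendieck_ring_def formal_diff_def)

lemma formal_diff_closed:
  "a \<in> carrier M \<Longrightarrow> b \<in> carrier M \<Longrightarrow> formal_diff M a b \<in> carrier (grothendieck_ring M)"
  by (auto simp: carrier_groth)

lemmas groth_simps =
  add_formal_diff mult_formal_diff zero_groth one_groth formal_diff_closed

text \<open>
  The semiring laws carry over to formal differences by computing with pairs; the negative of the
  difference of \<open>a\<close> and \<open>b\<close> is the difference of \<open>b\<close> and \<open>a\<close>.
\<close>

theorem ring_groth: "ring (grothendieck_ring M)"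
proof (rule ringI)
  let ?K = "grothendieck_ring M"
  show "abelian_group ?K"
  proof (rule abelian_groupI)
    fix P assume "P \<in> carrier ?K"
    then obtain a b where P: "a \<in> carrier M" "b \<in> carrier M" "P = formal_diff M a b"
      by (rule grothE)
    have "formal_diff M (b \<oplus> a) (a \<oplus> b) = formal_diff M \<zero> \<zero>"
      using P(1,2) by (subst formal_diff_eq_iff) (auto simp: a_ac)
    then have "formal_diff M b a \<oplus>\<^bsub>?K\<^esub> P = \<zero>\<^bsub>?K\<^esub>"
      using P by (simp add: groth_simps)
    then show "\<exists>Q\<in>carrier ?K. Q \<oplus>\<^bsub>?K\<^esub> P = \<zero>\<^bsub>?K\<^esub>"
      using P by (auto intro: formal_diff_closed)
  qed (auto elim!: grothE simp: groth_simps a_ac)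
  show "Group.monoid ?K"
    by (rule monoidI) (auto elim!: grothE simp: groth_simps l_distr r_distr m_assoc a_ac)
qed (auto elim!: grothE simp: groth_simps l_distr r_distr a_ac)

end

lemma ring_product_ring:
  assumes "\<And>i. i \<in> I \<Longrightarrow> ring (K i)"
  shows "ring (product_ring I K)"
proof (rule ringI)
  let ?P = "product_ring I K"
  have sel: "carrier ?P = (\<Pi>\<^sub>E i\<in>I. carrier (K i))"
    "\<And>p q. p \<oplus>\<^bsub>?P\<^esub> q = (\<lambda>i\<in>I. p i \<oplus>\<^bsub>K i\<^esub> q i)"
    "\<And>p q. p \<otimes>\<^bsub>?P\<^esub> q = (\<lambda>i\<in>I. p i \<otimes>\<^bsub>K i\<^esub> q i)"
    "\<zero>\<^bsub>?P\<^esub> = (\<lambda>i\<in>I. \<zero>\<^bsub>K i\<^esub>)" "\<one>\<^bsub>?P\<^esub> = (\<lambda>i\<in>I. \<one>\<^bsub>K i\<^esub>)"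
    by (simp_all add: product_ring_def)
  have ab: "abelian_group (K i)" and mon: "Group.monoid (K i)" if "i \<in> I" for i
    using assms[OF that] by (auto dest: ringE)
  show "abelian_group ?P"
  proof (rule abelian_groupI)
    fix p assume p: "p \<in> carrier ?P"
    let ?n = "\<lambda>i\<in>I. \<ominus>\<^bsub>K i\<^esub> p i"
    have "?n \<in> carrier ?P" and "?n \<oplus>\<^bsub>?P\<^esub> p = \<zero>\<^bsub>?P\<^esub>"
      using p by (auto simp: sel PiE_iff intro!: ext ab abelian_group.a_inv_closed
          abelian_group.l_neg)
    then show "\<exists>q\<in>carrier ?P. q \<oplus>\<^bsub>?P\<^esub> p = \<zero>\<^bsub>?P\<^esub>" by blast
  qed (auto simp: sel PiE_iff extensional_def fun_eq_iff abelian_groupE(1-3,5)[OF ab]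
      intro: abelian_groupE(4)[OF ab])
  show "Group.monoid ?P"
    by (rule monoidI)
      (auto simp: sel PiE_iff extensional_def fun_eq_iff mon
        intro: monoid.m_closed monoid.one_closed monoid.m_assoc monoid.l_one monoid.r_one)
qed (auto simp: product_ring_def PiE_iff fun_eq_iff ringE[OF assms])

text \<open>
  Each \<open>f i\<close> extends to formal differences. Surjectivity of the joint extension is lifted separately in
  the two entries of the pairs. For injectivity, the witnesses of equality found in the factors are
  the images of a single element of \<open>M\<close>, and joint injectivity turns the equations in the factors into
  one in \<open>M\<close>.
\<close>

lemma groth_product_iso:
  fixes M :: "'a ring" and N :: "'i \<Rightarrow> 'b ring"
  assumes "semiring M" and "\<And>i. i \<in> I \<Longrightarrow> semiring (N i)"
    and hom: "\<And>i. i \<in> I \<Longrightarrow> f i \<in> ring_hom M (N i)"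
    and f_zero: "\<And>i. i \<in> I \<Longrightarrow> f i \<zero>\<^bsub>M\<^esub> = \<zero>\<^bsub>N i\<^esub>"
    and inj: "\<And>a b. a \<in> carrier M \<Longrightarrow> b \<in> carrier M \<Longrightarrow> \<forall>i\<in>I. f i a = f i b \<Longrightarrow> a = b"
    and surj: "\<And>p. \<forall>i\<in>I. p i \<in> carrier (N i) \<Longrightarrow> \<exists>a\<in>carrier M. \<forall>i\<in>I. f i a = p i"
  shows "grothendieck_ring M \<simeq> product_ring I (\<lambda>i. grothendieck_ring (N i))"
proof -
  interpret M: semiring_completion M using assms(1) by (rule semiring_completion.intro)
  have N: "semiring_completion (N i)" if "i \<in> I" for i
    using assms(2)[OF that] by (rule semiring_completion.intro)
  let ?K = "grothendieck_ring M" and ?L = "\<lambda>i. grothendieck_ring (N i)"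
  define h where "h i P = (\<Union>(a, b)\<in>P. formal_diff (N i) (f i a) (f i b))" for i P
  note f = ring_hom_closed[OF hom] ring_hom_add[OF hom] ring_hom_mult[OF hom]
    ring_hom_one[OF hom] f_zero
  have h: "h i (formal_diff M a b) = formal_diff (N i) (f i a) (f i b)"
    if i: "i \<in> I" and ab: "a \<in> carrier M" "b \<in> carrier M" for i a b
    unfolding h_def
  proof (rule M.formal_diff_UN[OF ab])
    fix c d assume cd: "(c, d) \<in> formal_diff M a b"
    note car = M.formal_diff_mem[OF cd]
    then obtain k where k: "k \<in> carrier M" "c \<oplus>\<^bsub>M\<^esub> b \<oplus>\<^bsub>M\<^esub> k = a \<oplus>\<^bsub>M\<^esub> d \<oplus>\<^bsub>M\<^esub> k"
      by (auto simp: M.formal_diff_eq_iff)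
    have "f i (c \<oplus>\<^bsub>M\<^esub> b \<oplus>\<^bsub>M\<^esub> k) = f i (a \<oplus>\<^bsub>M\<^esub> d \<oplus>\<^bsub>M\<^esub> k)" by (simp only: k(2))
    then show "formal_diff (N i) (f i c) (f i d) = formal_diff (N i) (f i a) (f i b)"
      using car(1-4) k(1) i
      by (subst semiring_completion.formal_diff_eq_iff[OF N]) (auto simp: f intro!: bexI[of _ "f i k"])
  qed
  let ?h = "\<lambda>P. \<lambda>i\<in>I. h i P"
  have "?h \<in> ring_hom ?K (product_ring I ?L)"
  proof (rule ring_hom_memI)
    fix P assume "P \<in> carrier ?K"
    then show "?h P \<in> carrier (product_ring I ?L)"
      by (auto elim!: M.grothE simp: product_ring_def h f semiring_completion.formal_diff_closed[OF N])
  next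
    fix P Q assume "P \<in> carrier ?K" "Q \<in> carrier ?K"
    then show "?h (P \<otimes>\<^bsub>?K\<^esub> Q) = ?h P \<otimes>\<^bsub>product_ring I ?L\<^esub> ?h Q"
      and "?h (P \<oplus>\<^bsub>?K\<^esub> Q) = ?h P \<oplus>\<^bsub>product_ring I ?L\<^esub> ?h Q"
      by (auto elim!: M.grothE intro!: restrict_ext
          simp: product_ring_def h f M.add_formal_diff M.mult_formal_diff
            semiring_completion.add_formal_diff[OF N] semiring_completion.mult_formal_diff[OF N])
  next
    show "?h \<one>\<^bsub>?K\<^esub> = \<one>\<^bsub>product_ring I ?L\<^esub>"
      by (auto intro!: restrict_ext simp: product_ring_def M.one_groth semiring_completion.one_groth[OF N] h f)
  qed
  moreover have "inj_on ?h (carrier ?K)"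
  proof (rule inj_onI)
    fix P Q assume "P \<in> carrier ?K" "Q \<in> carrier ?K" and eq: "?h P = ?h Q"
    then obtain a b c d where P: "a \<in> carrier M" "b \<in> carrier M" "P = formal_diff M a b"
      and Q: "c \<in> carrier M" "d \<in> carrier M" "Q = formal_diff M c d"
      by (elim M.grothE) blast
    have "\<exists>k\<in>carrier (N i). f i a \<oplus>\<^bsub>N i\<^esub> f i d \<oplus>\<^bsub>N i\<^esub> k = f i c \<oplus>\<^bsub>N i\<^esub> f i b \<oplus>\<^bsub>N i\<^esub> k"
      if i: "i \<in> I" for i
    proof -
      have "formal_diff (N i) (f i a) (f i b) = formal_diff (N i) (f i c) (f i d)"
        using fun_cong[OF eq, of i] i P Q by (simp add: h)
      then show ?thesis
        using i P(1,2) Q(1,2) by (simp add: semiring_completion.formal_diff_eq_iff[OF N] f)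
    qed
    then obtain k where k: "\<forall>i\<in>I. k i \<in> carrier (N i) \<and>
        f i a \<oplus>\<^bsub>N i\<^esub> f i d \<oplus>\<^bsub>N i\<^esub> k i = f i c \<oplus>\<^bsub>N i\<^esub> f i b \<oplus>\<^bsub>N i\<^esub> k i"
      by metis
    then obtain l where l: "l \<in> carrier M" "\<forall>i\<in>I. f i l = k i"
      using surj[of k] by auto
    have "a \<oplus>\<^bsub>M\<^esub> d \<oplus>\<^bsub>M\<^esub> l = c \<oplus>\<^bsub>M\<^esub> b \<oplus>\<^bsub>M\<^esub> l"
      using P(1,2) Q(1,2) k l by (intro inj) (auto simp: f)
    then show "P = Q"
      using P Q l(1) by (auto simp: M.formal_diff_eq_iff)
  qed
  moreover have "carrier (product_ring I ?L) \<subseteq> ?h ` carrier ?K"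
  proof
    fix p assume p: "p \<in> carrier (product_ring I ?L)"
    have "\<exists>u v. u \<in> carrier (N i) \<and> v \<in> carrier (N i) \<and> p i = formal_diff (N i) u v"
      if i: "i \<in> I" for i
    proof -
      have "p i \<in> carrier (?L i)" using p i by (auto simp: product_ring_def)
      then show ?thesis by (auto simp: semiring_completion.carrier_groth[OF N[OF i]])
    qed
    then obtain u v where uv: "\<And>i. i \<in> I \<Longrightarrow>
        u i \<in> carrier (N i) \<and> v i \<in> carrier (N i) \<and> p i = formal_diff (N i) (u i) (v i)"
      by metis
    obtain a where a: "a \<in> carrier M" "\<forall>i\<in>I. f i a = u i" using surj[of u] uv by auto
    obtain b where b: "b \<in> carrier M" "\<forall>i\<in>I. f i b = v i" using surj[of v] uv by auto
    have "p = ?h (formal_diff M a b)"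
    proof
      fix i show "p i = ?h (formal_diff M a b) i"
        using p a b uv by (cases "i \<in> I") (auto simp: h product_ring_def)
    qed
    then show "p \<in> ?h ` carrier ?K" using a(1) b(1) M.formal_diff_closed by blast
  qed
  ultimately have "?h \<in> ring_iso ?K (product_ring I ?L)"
    by (auto simp: ring_iso_def bij_betw_def dest: ring_hom_closed)
  then show ?thesis by (auto simp: is_ring_iso_def)
qed

section \<open>The semiring of isomorphism classes of slice objects\<close>

lemma slice_isoE:
  fixes X :: "('o, 'm, 'a, 's) slice" and Y :: "('o, 'm, 'b, 's) slice"
  assumes "slice_iso C X Y"
  obtains \<phi> :: "'o \<Rightarrow> 'a \<Rightarrow> 'b" and \<psi> :: "'o \<Rightarrow> 'b \<Rightarrow> 'a" where
    "\<And>x a. x \<in> Obj C \<Longrightarrow> a \<in> fob X x \<Longrightarrow>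
      \<phi> x a \<in> fob Y x \<and> \<psi> x (\<phi> x a) = a \<and> str Y x (\<phi> x a) = str X x a"
    "\<And>x b. x \<in> Obj C \<Longrightarrow> b \<in> fob Y x \<Longrightarrow> \<psi> x b \<in> fob X x \<and> \<phi> x (\<psi> x b) = b"
    "\<And>g a. g \<in> Arr C \<Longrightarrow> a \<in> fob X (Src C g) \<Longrightarrow>
      \<phi> (Tgt C g) (fmap X g a) = fmap Y g (\<phi> (Src C g) a)"
proof -
  obtain \<phi> \<psi> where "\<phi> \<in> slice_hom C X Y" "\<psi> \<in> slice_hom C Y X"
    "\<forall>x\<in>Obj C. (\<forall>a\<in>fob X x. \<psi> x (\<phi> x a) = a) \<and> (\<forall>b\<in>fob Y x. \<phi> x (\<psi> x b) = b)"
    using assms by (auto simp: slice_iso_def)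
  then show thesis
    by (intro that[of \<phi> \<psi>]) (auto simp: slice_hom_def gmaps_def)
qed

lemma slice_iso_sym: "slice_iso C X Y \<Longrightarrow> slice_iso C Y X"
  unfolding slice_iso_def by blast

locale crossed_slices = category C for C :: "('o, 'm) cat" +
  fixes S :: "('o, 'm, 's) gmonoid"
  assumes gmonoid: "is_gmonoid C S"
begin

lemma monoid_mob: "x \<in> Obj C \<Longrightarrow> Group.monoid (mob S x)"
  using gmonoid by (simp add: is_gmonoid_def)

lemma mmap_mult:
  assumes "g \<in> Arr C" "s \<in> carrier (mob S (Src C g))" "t \<in> carrier (mob S (Src C g))"
  shows "mmap S g (s \<otimes>\<^bsub>mob S (Src C g)\<^esub> t) = mmap S g s \<otimes>\<^bsub>mob S (Tgt C g)\<^esub> mmap S g t"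
  using gmonoid assms by (simp add: is_gmonoid_def hom_def)

lemma mmap_one: "g \<in> Arr C \<Longrightarrow> mmap S g \<one>\<^bsub>mob S (Src C g)\<^esub> = \<one>\<^bsub>mob S (Tgt C g)\<^esub>"
  using gmonoid by (simp add: is_gmonoid_def)

lemma mmap_closed:
  assumes "g \<in> Arr C" "s \<in> carrier (mob S (Src C g))"
  shows "mmap S g s \<in> carrier (mob S (Tgt C g))"
  using gmonoid assms by (auto simp: is_gmonoid_def is_gset_def underlying_def)

lemma mmap_Idt: "x \<in> Obj C \<Longrightarrow> s \<in> carrier (mob S x) \<Longrightarrow> mmap S (Idt C x) s = s"
  using gmonoid by (simp add: is_gmonoid_def is_gset_def underlying_def)

lemma mmap_Cmp:
  assumes "g \<in> Arr C" "h \<in> Arr C" "Src C g = Tgt C h" "s \<in> carrier (mob S (Src C h))"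
  shows "mmap S (Cmp C g h) s = mmap S g (mmap S h s)"
  using gmonoid assms by (simp add: is_gmonoid_def is_gset_def underlying_def)

lemma slice_obj_iff:
  "slice_obj C S X \<longleftrightarrow>
    (\<forall>x\<in>Obj C. finite (fob X x)) \<and>
    (\<forall>g\<in>Arr C. \<forall>a\<in>fob X (Src C g). fmap X g a \<in> fob X (Tgt C g)) \<and>
    (\<forall>x\<in>Obj C. \<forall>a\<in>fob X x. fmap X (Idt C x) a = a) \<and>
    (\<forall>g\<in>Arr C. \<forall>h\<in>Arr C. Src C g = Tgt C h \<longrightarrow>
      (\<forall>a\<in>fob X (Src C h). fmap X (Cmp C g h) a = fmap X g (fmap X h a))) \<and>
    (\<forall>x\<in>Obj C. \<forall>a\<in>fob X x. str X x a \<in> carrier (mob S x)) \<and>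
    (\<forall>g\<in>Arr C. \<forall>a\<in>fob X (Src C g). str X (Tgt C g) (fmap X g a) = mmap S g (str X (Src C g) a))"
  by (auto simp: slice_obj_def is_gset_def gmaps_def underlying_def Pi_iff)

lemma slice_objD:
  assumes "slice_obj C S X"
  shows "x \<in> Obj C \<Longrightarrow> finite (fob X x)"
    and "g \<in> Arr C \<Longrightarrow> a \<in> fob X (Src C g) \<Longrightarrow> fmap X g a \<in> fob X (Tgt C g)"
    and "x \<in> Obj C \<Longrightarrow> a \<in> fob X x \<Longrightarrow> fmap X (Idt C x) a = a"
    and "g \<in> Arr C \<Longrightarrow> h \<in> Arr C \<Longrightarrow> Src C g = Tgt C h \<Longrightarrow> a \<in> fob X (Src C h) \<Longrightarrow>
      fmap X (Cmp C g h) a = fmap X g (fmap X h a)"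
    and "x \<in> Obj C \<Longrightarrow> a \<in> fob X x \<Longrightarrow> str X x a \<in> carrier (mob S x)"
    and "g \<in> Arr C \<Longrightarrow> a \<in> fob X (Src C g) \<Longrightarrow>
      str X (Tgt C g) (fmap X g a) = mmap S g (str X (Src C g) a)"
  using assms by (auto simp: slice_obj_iff)

text \<open>
  Naturality and compatibility with the structure maps are required in one direction only; the inverse
  inherits them.
\<close>

lemma slice_isoI:
  fixes \<phi> :: "'o \<Rightarrow> 'a \<Rightarrow> 'b" and \<psi> :: "'o \<Rightarrow> 'b \<Rightarrow> 'a"
  assumes X: "slice_obj C S X"
    and \<phi>: "\<And>x a. x \<in> Obj C \<Longrightarrow> a \<in> fob X x \<Longrightarrow>
      \<phi> x a \<in> fob Y x \<and> \<psi> x (\<phi> x a) = a \<and> str Y x (\<phi> x a) = str X x a"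
    and \<psi>: "\<And>x b. x \<in> Obj C \<Longrightarrow> b \<in> fob Y x \<Longrightarrow> \<psi> x b \<in> fob X x \<and> \<phi> x (\<psi> x b) = b"
    and nat: "\<And>g a. g \<in> Arr C \<Longrightarrow> a \<in> fob X (Src C g) \<Longrightarrow>
      \<phi> (Tgt C g) (fmap X g a) = fmap Y g (\<phi> (Src C g) a)"
  shows "slice_iso C X Y"
  unfolding slice_iso_def
proof (intro bexI[of _ \<phi>] bexI[of _ \<psi>])
  show "\<phi> \<in> slice_hom C X Y"
    using \<phi> nat by (auto simp: slice_hom_def gmaps_def)
  have "\<psi> (Tgt C g) (fmap Y g b) = fmap X g (\<psi> (Src C g) b)"
    if g: "g \<in> Arr C" and b: "b \<in> fob Y (Src C g)" for g b
  proof -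
    have a: "\<psi> (Src C g) b \<in> fob X (Src C g)" "\<phi> (Src C g) (\<psi> (Src C g) b) = b"
      using \<psi> b Src_closed[OF g] by auto
    then have "fmap Y g b = \<phi> (Tgt C g) (fmap X g (\<psi> (Src C g) b))"
      using nat[OF g] by simp
    then show ?thesis
      using \<phi>[OF Tgt_closed[OF g] slice_objD(2)[OF X g a(1)]] by simp
  qed
  moreover have "str X x (\<psi> x b) = str Y x b" if "x \<in> Obj C" "b \<in> fob Y x" for x b
    using \<phi>[of x "\<psi> x b"] \<psi>[of x b] that by simp
  ultimately show "\<psi> \<in> slice_hom C Y X"
    using \<psi> by (auto simp: slice_hom_def gmaps_def)
qed (use \<phi> \<psi> in auto)

lemma slice_iso_trans:
  assumes X: "slice_obj C S X" and XY: "slice_iso C X Y" and YZ: "slice_iso C Y Z"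
  shows "slice_iso C X Z"
proof (rule slice_isoE[OF XY], rule slice_isoE[OF YZ])
  fix \<phi> \<psi> \<phi>' \<psi>'
  assume a: "\<And>x a. x \<in> Obj C \<Longrightarrow> a \<in> fob X x \<Longrightarrow>
      \<phi> x a \<in> fob Y x \<and> \<psi> x (\<phi> x a) = a \<and> str Y x (\<phi> x a) = str X x a"
    "\<And>x b. x \<in> Obj C \<Longrightarrow> b \<in> fob Y x \<Longrightarrow> \<psi> x b \<in> fob X x \<and> \<phi> x (\<psi> x b) = b"
    "\<And>g a. g \<in> Arr C \<Longrightarrow> a \<in> fob X (Src C g) \<Longrightarrow>
      \<phi> (Tgt C g) (fmap X g a) = fmap Y g (\<phi> (Src C g) a)"
    and b: "\<And>x a. x \<in> Obj C \<Longrightarrow> a \<in> fob Y x \<Longrightarrow>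
      \<phi>' x a \<in> fob Z x \<and> \<psi>' x (\<phi>' x a) = a \<and> str Z x (\<phi>' x a) = str Y x a"
    "\<And>x b. x \<in> Obj C \<Longrightarrow> b \<in> fob Z x \<Longrightarrow> \<psi>' x b \<in> fob Y x \<and> \<phi>' x (\<psi>' x b) = b"
    "\<And>g a. g \<in> Arr C \<Longrightarrow> a \<in> fob Y (Src C g) \<Longrightarrow>
      \<phi>' (Tgt C g) (fmap Y g a) = fmap Z g (\<phi>' (Src C g) a)"
  show ?thesis
    by (rule slice_isoI[OF X, where \<phi> = "\<lambda>x a. \<phi>' x (\<phi> x a)" and \<psi> = "\<lambda>x c. \<psi> x (\<psi>' x c)"])
      (auto simp: a b Src_closed)
qed

text \<open>
  Every isomorphism class is represented among the slice objects with values in the natural numbers: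
  the structure is transported along chosen injections of the finite sets. Hence \<open>iso_class\<close> is never
  empty, and sums and tensor products, whose values lie in sum and product types, have a class again.
\<close>

lemma nat_model:
  assumes X: "slice_obj C S X"
  obtains Y :: "('o, 'm, nat, 's) slice" where "slice_obj C S Y" "slice_iso C X Y"
proof -
  have "\<exists>f :: _ \<Rightarrow> nat. inj_on f (fob X x)" if "x \<in> Obj C" for x
    using finite_imp_inj_to_nat_seg[OF slice_objD(1)[OF X that]] by blast
  then obtain e :: "'o \<Rightarrow> _ \<Rightarrow> nat" where e: "\<And>x. x \<in> Obj C \<Longrightarrow> inj_on (e x) (fob X x)"
    by metis
  define d where "d x = inv_into (fob X x) (e x)" for x
  define Y :: "('o, 'm, nat, 's) slice" where
    "Y = \<lparr>fob = \<lambda>x. e x ` fob X x, fmap = \<lambda>g n. e (Tgt C g) (fmap X g (d (Src C g) n)),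
      str = \<lambda>x n. str X x (d x n)\<rparr>"
  have d: "d x (e x a) = a" if "x \<in> Obj C" "a \<in> fob X x" for x a
    using e that by (simp add: d_def)
  have hom: "Src C (Idt C x) = x" "Tgt C (Idt C x) = x" "Idt C x \<in> Arr C" if "x \<in> Obj C" for x
    using Idt_closed[OF that] by (auto simp: Hom_def)
  have cmp: "Src C (Cmp C g h) = Src C h" "Tgt C (Cmp C g h) = Tgt C g" "Cmp C g h \<in> Arr C"
    if "g \<in> Arr C" "h \<in> Arr C" "Src C g = Tgt C h" for g h
    using Cmp_closed[of g "Src C g" "Tgt C g" h "Src C h"] that by (auto simp: Hom_def)
  have "slice_obj C S Y"
    unfolding slice_obj_iff Y_def
    by (auto simp: d hom cmp Src_closed Tgt_closed slice_objD[OF X])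
  moreover have "slice_iso C X Y"
    by (rule slice_isoI[OF X, where \<phi> = e and \<psi> = d])
      (auto simp: Y_def d Src_closed)
  ultimately show thesis by (rule that)
qed

lemma slice_obj_sum:
  assumes "slice_obj C S X" "slice_obj C S Y"
  shows "slice_obj C S (slice_sum X Y)"
  unfolding slice_obj_iff slice_sum_def
  by (auto simp: slice_objD[OF assms(1)] slice_objD[OF assms(2)] elim!: PlusE)

lemma slice_obj_tensor:
  assumes "slice_obj C S X" "slice_obj C S Y"
  shows "slice_obj C S (slice_tensor S X Y)"
  unfolding slice_obj_iff slice_tensor_def
  by (auto simp: slice_objD[OF assms(1)] slice_objD[OF assms(2)] monoid.m_closed[OF monoid_mob]
      mmap_mult Src_closed)

lemma slice_obj_empty: "slice_obj C S slice_empty"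
  by (simp add: slice_obj_iff slice_empty_def)

lemma slice_obj_unit: "slice_obj C S (slice_unit S)"
  by (simp add: slice_obj_iff slice_unit_def monoid.one_closed[OF monoid_mob] mmap_one)

lemma slice_sum_cong:
  assumes obj: "slice_obj C S X" "slice_obj C S Y"
    and XX: "slice_iso C X X'" and YY: "slice_iso C Y Y'"
  shows "slice_iso C (slice_sum X Y) (slice_sum X' Y')"
proof (rule slice_isoE[OF XX], rule slice_isoE[OF YY])
  fix \<phi> \<psi> \<phi>' \<psi>'
  assume a: "\<And>x a. x \<in> Obj C \<Longrightarrow> a \<in> fob X x \<Longrightarrow>
      \<phi> x a \<in> fob X' x \<and> \<psi> x (\<phi> x a) = a \<and> str X' x (\<phi> x a) = str X x a"
    "\<And>x b. x \<in> Obj C \<Longrightarrow> b \<in> fob X' x \<Longrightarrow> \<psi> x b \<in> fob X x \<and> \<phi> x (\<psi> x b) = b"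
    "\<And>g a. g \<in> Arr C \<Longrightarrow> a \<in> fob X (Src C g) \<Longrightarrow>
      \<phi> (Tgt C g) (fmap X g a) = fmap X' g (\<phi> (Src C g) a)"
    and b: "\<And>x a. x \<in> Obj C \<Longrightarrow> a \<in> fob Y x \<Longrightarrow>
      \<phi>' x a \<in> fob Y' x \<and> \<psi>' x (\<phi>' x a) = a \<and> str Y' x (\<phi>' x a) = str Y x a"
    "\<And>x b. x \<in> Obj C \<Longrightarrow> b \<in> fob Y' x \<Longrightarrow> \<psi>' x b \<in> fob Y x \<and> \<phi>' x (\<psi>' x b) = b"
    "\<And>g a. g \<in> Arr C \<Longrightarrow> a \<in> fob Y (Src C g) \<Longrightarrow>
      \<phi>' (Tgt C g) (fmap Y g a) = fmap Y' g (\<phi>' (Src C g) a)"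
  show ?thesis
    by (rule slice_isoI[OF slice_obj_sum[OF obj],
          where \<phi> = "\<lambda>x. map_sum (\<phi> x) (\<phi>' x)" and \<psi> = "\<lambda>x. map_sum (\<psi> x) (\<psi>' x)"])
      (auto simp: slice_sum_def a b elim!: PlusE)
qed

lemma slice_tensor_cong:
  assumes obj: "slice_obj C S X" "slice_obj C S Y"
    and XX: "slice_iso C X X'" and YY: "slice_iso C Y Y'"
  shows "slice_iso C (slice_tensor S X Y) (slice_tensor S X' Y')"
proof (rule slice_isoE[OF XX], rule slice_isoE[OF YY])
  fix \<phi> \<psi> \<phi>' \<psi>'
  assume a: "\<And>x a. x \<in> Obj C \<Longrightarrow> a \<in> fob X x \<Longrightarrow>
      \<phi> x a \<in> fob X' x \<and> \<psi> x (\<phi> x a) = a \<and> str X' x (\<phi> x a) = str X x a"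
    "\<And>x b. x \<in> Obj C \<Longrightarrow> b \<in> fob X' x \<Longrightarrow> \<psi> x b \<in> fob X x \<and> \<phi> x (\<psi> x b) = b"
    "\<And>g a. g \<in> Arr C \<Longrightarrow> a \<in> fob X (Src C g) \<Longrightarrow>
      \<phi> (Tgt C g) (fmap X g a) = fmap X' g (\<phi> (Src C g) a)"
    and b: "\<And>x a. x \<in> Obj C \<Longrightarrow> a \<in> fob Y x \<Longrightarrow>
      \<phi>' x a \<in> fob Y' x \<and> \<psi>' x (\<phi>' x a) = a \<and> str Y' x (\<phi>' x a) = str Y x a"
    "\<And>x b. x \<in> Obj C \<Longrightarrow> b \<in> fob Y' x \<Longrightarrow> \<psi>' x b \<in> fob Y x \<and> \<phi>' x (\<psi>' x b) = b"
    "\<And>g a. g \<in> Arr C \<Longrightarrow> a \<in> fob Y (Src C g) \<Longrightarrow>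
      \<phi>' (Tgt C g) (fmap Y g a) = fmap Y' g (\<phi>' (Src C g) a)"
  show ?thesis
    by (rule slice_isoI[OF slice_obj_tensor[OF obj],
          where \<phi> = "\<lambda>x. map_prod (\<phi> x) (\<phi>' x)" and \<psi> = "\<lambda>x. map_prod (\<psi> x) (\<psi>' x)"])
      (auto simp: slice_tensor_def a b)
qed

lemma iso_class_eq_iff:
  assumes X: "slice_obj C S X" and Y: "slice_obj C S Y"
  shows "iso_class C S X = iso_class C S Y \<longleftrightarrow> slice_iso C X Y"
proof
  assume eq: "iso_class C S X = iso_class C S Y"
  obtain Z :: "('o, 'm, nat, 's) slice" where Z: "slice_obj C S Z" "slice_iso C X Z"
    by (rule nat_model[OF X])
  then have "Z \<in> iso_class C S Y" using eq by (auto simp: iso_class_def)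
  then have "slice_iso C Z Y" by (auto simp: iso_class_def intro: slice_iso_sym)
  with X Z(2) show "slice_iso C X Y" by (rule slice_iso_trans)
next
  assume XY: "slice_iso C X Y"
  show "iso_class C S X = iso_class C S Y"
    using slice_iso_trans[OF X XY] slice_iso_trans[OF Y slice_iso_sym[OF XY]]
    by (auto simp: iso_class_def)
qed

lemmas iso_class_eqI = iso_class_eq_iff[THEN iffD2]

text \<open>
  The operations on classes are unions over representatives; this reduces them to any chosen
  representative, with values in an arbitrary type.
\<close>

lemma iso_class_UN:
  assumes X: "slice_obj C S X"
    and F: "\<And>Y. slice_obj C S Y \<Longrightarrow> slice_iso C X Y \<Longrightarrow> F Y = K"
  shows "(\<Union>Y\<in>iso_class C S X. F Y) = K"
proof -
  obtain Z :: "('o, 'm, nat, 's) slice" where "slice_obj C S Z" "slice_iso C X Z"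
    by (rule nat_model[OF X])
  then have "Z \<in> iso_class C S X" by (simp add: iso_class_def)
  moreover have "(\<Union>Y\<in>iso_class C S X. F Y) = (\<Union>Y\<in>iso_class C S X. K)"
    by (rule SUP_cong) (auto simp: iso_class_def F)
  ultimately show ?thesis by auto
qed

lemma iso_class_closed:
  assumes X: "slice_obj C S X"
  shows "iso_class C S X \<in> carrier (iso_semiring C S)"
proof -
  obtain Z :: "('o, 'm, nat, 's) slice" where Z: "slice_obj C S Z" "slice_iso C X Z"
    by (rule nat_model[OF X])
  then have "iso_class C S X = iso_class C S Z" by (intro iso_class_eqI X)
  with Z show ?thesis by (auto simp: iso_semiring_def)
qed

lemma iso_semiringE:
  assumes "P \<in> carrier (iso_semiring C S)"
  obtains X :: "('o, 'm, nat, 's) slice" where "slice_obj C S X" "P = iso_class C S X"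
  using assms by (auto simp: iso_semiring_def)

lemma add_iso_class:
  assumes "slice_obj C S X" "slice_obj C S Y"
  shows "iso_class C S X \<oplus>\<^bsub>iso_semiring C S\<^esub> iso_class C S Y = iso_class C S (slice_sum X Y)"
  unfolding iso_semiring_def ring.simps
  by (intro iso_class_UN assms iso_class_eqI slice_obj_sum)
    (simp_all add: slice_iso_sym[OF slice_sum_cong] assms)

lemma mult_iso_class:
  assumes "slice_obj C S X" "slice_obj C S Y"
  shows "iso_class C S X \<otimes>\<^bsub>iso_semiring C S\<^esub> iso_class C S Y = iso_class C S (slice_tensor S X Y)"
  unfolding iso_semiring_def monoid.simps
  by (intro iso_class_UN assms iso_class_eqI slice_obj_tensor)
    (simp_all add: slice_iso_sym[OF slice_tensor_cong] assms)

lemma zero_iso_class: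
  "\<zero>\<^bsub>iso_semiring C S\<^esub> = iso_class C S (slice_empty :: ('o, 'm, nat, 's) slice)"
  and one_iso_class: "\<one>\<^bsub>iso_semiring C S\<^esub> = iso_class C S (slice_unit S)"
  by (simp_all add: iso_semiring_def)

lemmas iso_class_simps = add_iso_class mult_iso_class zero_iso_class one_iso_class
  iso_class_closed slice_obj_sum slice_obj_tensor slice_obj_empty slice_obj_unit

lemma sum_assoc_iso:
  assumes "slice_obj C S X" "slice_obj C S Y" "slice_obj C S Z"
  shows "slice_iso C (slice_sum (slice_sum X Y) Z) (slice_sum X (slice_sum Y Z))"
  by (rule slice_isoI[OF slice_obj_sum[OF slice_obj_sum[OF assms(1,2)] assms(3)], where
        \<phi> = "\<lambda>_. case_sum (case_sum Inl (Inr \<circ> Inl)) (Inr \<circ> Inr)"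
        and \<psi> = "\<lambda>_. case_sum (Inl \<circ> Inl) (case_sum (Inl \<circ> Inr) Inr)"])
    (auto simp: slice_sum_def)

lemma sum_comm_iso:
  assumes "slice_obj C S X" "slice_obj C S Y"
  shows "slice_iso C (slice_sum X Y) (slice_sum Y X)"
  by (rule slice_isoI[OF slice_obj_sum[OF assms],
        where \<phi> = "\<lambda>_. case_sum Inr Inl" and \<psi> = "\<lambda>_. case_sum Inr Inl"])
    (auto simp: slice_sum_def)

lemma sum_empty_iso:
  assumes "slice_obj C S X"
  shows "slice_iso C (slice_sum slice_empty X) X"
  by (rule slice_isoI[OF slice_obj_sum[OF slice_obj_empty assms],
        where \<phi> = "\<lambda>_. case_sum undefined id" and \<psi> = "\<lambda>_. Inr"])
    (auto simp: slice_sum_def slice_empty_def)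

lemma tensor_assoc_iso:
  assumes X: "slice_obj C S X" and Y: "slice_obj C S Y" and Z: "slice_obj C S Z"
  shows "slice_iso C (slice_tensor S (slice_tensor S X Y) Z) (slice_tensor S X (slice_tensor S Y Z))"
  by (rule slice_isoI[OF slice_obj_tensor[OF slice_obj_tensor[OF X Y] Z], where
        \<phi> = "\<lambda>_ ((a, b), c). (a, (b, c))" and \<psi> = "\<lambda>_ (a, (b, c)). ((a, b), c)"])
    (auto simp: slice_tensor_def monoid.m_assoc[OF monoid_mob]
      slice_objD(5)[OF X] slice_objD(5)[OF Y] slice_objD(5)[OF Z])

lemma tensor_unit_iso:
  assumes X: "slice_obj C S X"
  shows "slice_iso C (slice_tensor S (slice_unit S) X) X"
    and "slice_iso C (slice_tensor S X (slice_unit S)) X"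
proof -
  show "slice_iso C (slice_tensor S (slice_unit S) X) X"
    by (rule slice_isoI[OF slice_obj_tensor[OF slice_obj_unit X],
          where \<phi> = "\<lambda>_. snd" and \<psi> = "\<lambda>_ a. ((), a)"])
      (auto simp: slice_tensor_def slice_unit_def monoid.l_one[OF monoid_mob] slice_objD(5)[OF X])
  show "slice_iso C (slice_tensor S X (slice_unit S)) X"
    by (rule slice_isoI[OF slice_obj_tensor[OF X slice_obj_unit],
          where \<phi> = "\<lambda>_. fst" and \<psi> = "\<lambda>_ a. (a, ())"])
      (auto simp: slice_tensor_def slice_unit_def monoid.r_one[OF monoid_mob] slice_objD(5)[OF X])
qed

lemma tensor_sum_iso:
  assumes "slice_obj C S X" "slice_obj C S Y" "slice_obj C S Z"
  shows "slice_iso C (slice_tensor S (slice_sum X Y) Z)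
      (slice_sum (slice_tensor S X Z) (slice_tensor S Y Z))"
    and "slice_iso C (slice_tensor S Z (slice_sum X Y))
      (slice_sum (slice_tensor S Z X) (slice_tensor S Z Y))"
proof -
  show "slice_iso C (slice_tensor S (slice_sum X Y) Z)
      (slice_sum (slice_tensor S X Z) (slice_tensor S Y Z))"
    by (rule slice_isoI[OF slice_obj_tensor[OF slice_obj_sum[OF assms(1,2)] assms(3)], where
          \<phi> = "\<lambda>_ (u, c). case u of Inl a \<Rightarrow> Inl (a, c) | Inr b \<Rightarrow> Inr (b, c)"
          and \<psi> = "\<lambda>_. case_sum (\<lambda>(a, c). (Inl a, c)) (\<lambda>(b, c). (Inr b, c))"])
      (auto simp: slice_tensor_def slice_sum_def elim!: PlusE)
  show "slice_iso C (slice_tensor S Z (slice_sum X Y))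
      (slice_sum (slice_tensor S Z X) (slice_tensor S Z Y))"
    by (rule slice_isoI[OF slice_obj_tensor[OF assms(3) slice_obj_sum[OF assms(1,2)]], where
          \<phi> = "\<lambda>_ (c, u). case u of Inl a \<Rightarrow> Inl (c, a) | Inr b \<Rightarrow> Inr (c, b)"
          and \<psi> = "\<lambda>_. case_sum (\<lambda>(c, a). (c, Inl a)) (\<lambda>(c, b). (c, Inr b))"])
      (auto simp: slice_tensor_def slice_sum_def elim!: PlusE)
qed

lemma tensor_empty_iso:
  assumes X: "slice_obj C S X"
  shows "slice_iso C (slice_tensor S slice_empty X) slice_empty"
    and "slice_iso C (slice_tensor S X slice_empty) slice_empty"
proof -
  show "slice_iso C (slice_tensor S slice_empty X) slice_empty"
    by (rule slice_isoI[OF slice_obj_tensor[OF slice_obj_empty X]])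
      (auto simp: slice_tensor_def slice_empty_def)
  show "slice_iso C (slice_tensor S X slice_empty) slice_empty"
    by (rule slice_isoI[OF slice_obj_tensor[OF X slice_obj_empty]])
      (auto simp: slice_tensor_def slice_empty_def)
qed

text \<open>
  By \<open>add_iso_class\<close> and \<open>mult_iso_class\<close>, each law is the existence of the corresponding isomorphism
  between representatives.
\<close>

theorem semiring_iso_semiring: "semiring (iso_semiring C S)"
proof (intro semiring.intro semiring_axioms.intro)
  show "abelian_monoid (iso_semiring C S)"
    by (rule abelian_monoidI; (elim iso_semiringE)?;
        simp add: iso_class_simps iso_class_eq_iff sum_assoc_iso sum_comm_iso sum_empty_iso)
  show "Group.monoid (iso_semiring C S)"
    by (rule monoidI; (elim iso_semiringE)?;
        simp add: iso_class_simps iso_class_eq_iff tensor_assoc_iso tensor_unit_iso)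
qed (elim iso_semiringE;
    simp add: iso_class_simps iso_class_eq_iff tensor_sum_iso tensor_empty_iso)+

theorem ring_crossed_burnside_over: "ring (crossed_burnside_over C S)"
  unfolding crossed_burnside_over_def
  by (rule semiring_completion.ring_groth[OF semiring_completion.intro]) (rule semiring_iso_semiring)

end

section \<open>Groupoids and their isotropy groups\<close>

context category
begin

lemma Idt_simps:
  "x \<in> Obj C \<Longrightarrow> Idt C x \<in> Arr C" "x \<in> Obj C \<Longrightarrow> Src C (Idt C x) = x"
  "x \<in> Obj C \<Longrightarrow> Tgt C (Idt C x) = x"
  "g \<in> Arr C \<Longrightarrow> Tgt C g = x \<Longrightarrow> Cmp C (Idt C x) g = g"
  "g \<in> Arr C \<Longrightarrow> Src C g = x \<Longrightarrow> Cmp C g (Idt C x) = g"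
  using Idt_closed Cmp_Idt_left Cmp_Idt_right by (auto simp: Hom_def)

lemma Cmp_simps:
  assumes "g \<in> Arr C" "h \<in> Arr C" "Src C g = Tgt C h"
  shows "Cmp C g h \<in> Arr C" "Src C (Cmp C g h) = Src C h" "Tgt C (Cmp C g h) = Tgt C g"
    and "k \<in> Arr C \<Longrightarrow> Src C h = Tgt C k \<Longrightarrow> Cmp C (Cmp C g h) k = Cmp C g (Cmp C h k)"
  using Cmp_closed[of g _ _ h] Cmp_assoc[of g _ _ h _ k] assms by (auto simp: Hom_def)

text \<open>
  Stated with explicit sources and targets, the category laws form a conditional rewrite system that
  brings composites into right-nested form and decides composability along the way.
\<close>

lemmas arr_simps = Src_closed Tgt_closed Idt_simps Cmp_simps

end

context groupoid
begin

lemma is_inverse_unique: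
  assumes "g \<in> Hom C x y" "is_inverse C g h" "is_inverse C g h'"
  shows "h = h'"
proof -
  have g: "Src C g = x" "Tgt C g = y" using assms(1) by (auto simp: Hom_def)
  have h: "h \<in> Hom C y x" "Cmp C h g = Idt C x" and h': "h' \<in> Hom C y x" "Cmp C g h' = Idt C y"
    using assms(2,3) by (auto simp: is_inverse_def g)
  have "h = Cmp C h (Cmp C g h')" using h h' by (simp add: Cmp_Idt_right)
  also have "\<dots> = Cmp C (Cmp C h g) h'" using Cmp_assoc[OF h(1) assms(1) h'(1)] by simp
  also have "\<dots> = h'" using h h' by (simp add: Cmp_Idt_left)
  finally show ?thesis .
qed

lemma arr_inv_eqI:
  assumes "g \<in> Hom C x y" "h \<in> Hom C y x" "Cmp C h g = Idt C x" "Cmp C g h = Idt C y"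
  shows "arr_inv C g = h"
proof -
  have "is_inverse C g h" using assms by (auto simp: is_inverse_def Hom_def)
  then show ?thesis
    unfolding arr_inv_def by (blast intro: the_equality is_inverse_unique[OF assms(1)])
qed

lemma arr_inv:
  assumes "g \<in> Hom C x y"
  shows "arr_inv C g \<in> Hom C y x" "Cmp C (arr_inv C g) g = Idt C x" "Cmp C g (arr_inv C g) = Idt C y"
proof -
  obtain h where "is_inverse C g h" using invertible assms by (auto simp: Hom_def)
  then have h: "h \<in> Hom C y x" "Cmp C h g = Idt C x" "Cmp C g h = Idt C y"
    using assms by (auto simp: is_inverse_def Hom_def)
  with arr_inv_eqI[OF assms h] show "arr_inv C g \<in> Hom C y x"
    "Cmp C (arr_inv C g) g = Idt C x" "Cmp C g (arr_inv C g) = Idt C y"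
    by simp_all
qed

lemma arr_inv_simps:
  assumes "g \<in> Arr C"
  shows "arr_inv C g \<in> Arr C" "Src C (arr_inv C g) = Tgt C g" "Tgt C (arr_inv C g) = Src C g"
    and "Cmp C (arr_inv C g) g = Idt C (Src C g)" "Cmp C g (arr_inv C g) = Idt C (Tgt C g)"
  using arr_inv[of g "Src C g" "Tgt C g"] assms by (auto simp: Hom_def)

lemma Cmp_arr_inv_cancel:
  assumes "g \<in> Arr C" "h \<in> Arr C"
  shows "Src C g = Tgt C h \<Longrightarrow> Cmp C (arr_inv C g) (Cmp C g h) = h"
    and "Tgt C g = Tgt C h \<Longrightarrow> Cmp C g (Cmp C (arr_inv C g) h) = h"
  using assms by (simp_all flip: Cmp_simps(4) add: arr_inv_simps Idt_simps)

lemmas groupoid_simps = arr_simps arr_inv_simps Cmp_arr_inv_cancel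

lemma arr_inv_Idt: "x \<in> Obj C \<Longrightarrow> arr_inv C (Idt C x) = Idt C x"
  by (rule arr_inv_eqI[OF Idt_closed Idt_closed]) (simp_all add: arr_simps)

lemma arr_inv_Cmp:
  assumes "g \<in> Arr C" "h \<in> Arr C" "Src C g = Tgt C h"
  shows "arr_inv C (Cmp C g h) = Cmp C (arr_inv C h) (arr_inv C g)"
  by (rule arr_inv_eqI[of _ "Src C h" "Tgt C g"]) (simp_all add: Hom_def groupoid_simps assms)

end

lemma one_object_isotropy_simps:
  "Obj (one_object (isotropy C x)) = {()}"
  "Arr (one_object (isotropy C x)) = Hom C x x"
  "Src (one_object (isotropy C x)) g = ()"
  "Tgt (one_object (isotropy C x)) g = ()"
  "Cmp (one_object (isotropy C x)) = Cmp C"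
  "Idt (one_object (isotropy C x)) u = Idt C x"
  "Hom (one_object (isotropy C x)) u v = Hom C x x"
  by (auto simp: one_object_def isotropy_def Hom_def)

lemma (in category) monoid_isotropy:
  assumes "x \<in> Obj C"
  shows "Group.monoid (isotropy C x)"
  using assms
  by unfold_locales (auto simp: isotropy_def Cmp_closed Idt_closed Cmp_Idt_left Cmp_Idt_right
      intro: Cmp_assoc)

lemma (in category) category_isotropy:
  assumes "x \<in> Obj C"
  shows "category (one_object (isotropy C x))"
  using assms
  by unfold_locales (auto simp: one_object_isotropy_simps Idt_closed Cmp_Idt_left Cmp_Idt_right
      intro: Cmp_closed Cmp_assoc)

lemma (in finite_groupoid) gmonoid_conj_action: "is_gmonoid C (conj_action C)"
proof -
  have fin: "finite (Hom C x y)" for x y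
    by (rule finite_subset[OF _ finite_Arr]) (auto simp: Hom_def)
  show ?thesis
    unfolding is_gmonoid_def is_gset_def underlying_def conj_action_def
    by (auto simp: fin[unfolded Hom_def] monoid_isotropy[unfolded isotropy_def Hom_def]
        isotropy_def hom_def Hom_def groupoid_simps
        arr_inv_Idt arr_inv_Cmp)
qed

section \<open>Restriction to an isotropy group\<close>

definition restrict_gmonoid :: "'o \<Rightarrow> ('o, 'm, 's) gmonoid \<Rightarrow> (unit, 'm, 's) gmonoid" where
  "restrict_gmonoid x S = \<lparr>mob = \<lambda>_. mob S x, mmap = mmap S\<rparr>"

definition restrict_slice :: "'o \<Rightarrow> ('o, 'm, 'a, 's) slice \<Rightarrow> (unit, 'm, 'a, 's) slice" where
  "restrict_slice x X = \<lparr>fob = \<lambda>_. fob X x, fmap = fmap X, str = \<lambda>_. str X x\<rparr>"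

text \<open>
  Both operations and their neutral objects are formed pointwise, so restriction commutes with them up to equality and not merely up to
  isomorphism.
\<close>

lemma restrict_slice_simps:
  "restrict_slice x (slice_sum X Y) = slice_sum (restrict_slice x X) (restrict_slice x Y)"
  "restrict_slice x (slice_tensor S X Y)
    = slice_tensor (restrict_gmonoid x S) (restrict_slice x X) (restrict_slice x Y)"
  "restrict_slice x slice_empty = slice_empty"
  "restrict_slice x (slice_unit S) = slice_unit (restrict_gmonoid x S)"
  by (simp_all add: restrict_slice_def restrict_gmonoid_def slice_sum_def slice_tensor_def
      slice_empty_def slice_unit_def)

context crossed_slices
begin

lemma crossed_slices_restrict:
  assumes "x \<in> Obj C"
  shows "crossed_slices (one_object (isotropy C x)) (restrict_gmonoid x S)"
proof (intro crossed_slices.intro crossed_slices_axioms.intro category_isotropy assms)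
  show "is_gmonoid (one_object (isotropy C x)) (restrict_gmonoid x S)"
    using gmonoid assms
    by (auto simp: is_gmonoid_def is_gset_def underlying_def restrict_gmonoid_def
        one_object_isotropy_simps Hom_def Pi_iff)
qed

lemma slice_obj_restrict:
  assumes "x \<in> Obj C" and X: "slice_obj C S X"
  shows "slice_obj (one_object (isotropy C x)) (restrict_gmonoid x S) (restrict_slice x X)"
proof -
  have "fmap X g a \<in> fob X x" "str X x (fmap X g a) = mmap S g (str X x a)"
      "\<And>h. h \<in> Hom C x x \<Longrightarrow> fmap X (Cmp C h g) a = fmap X h (fmap X g a)"
    if "g \<in> Hom C x x" "a \<in> fob X x" for g a
    using slice_objD(2,6)[OF X, of g a] slice_objD(4)[OF X, of _ g a] that
    by (auto simp: Hom_def)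
  then show ?thesis
    unfolding crossed_slices.slice_obj_iff[OF crossed_slices_restrict[OF assms(1)]]
    by (auto simp: restrict_slice_def restrict_gmonoid_def one_object_isotropy_simps
        slice_objD(1,3,5)[OF X] assms(1))
qed

lemma slice_iso_restrict:
  assumes x: "x \<in> Obj C" and X: "slice_obj C S X" and XY: "slice_iso C X Y"
  shows "slice_iso (one_object (isotropy C x)) (restrict_slice x X) (restrict_slice x Y)"
proof (rule slice_isoE[OF XY])
  fix \<phi> \<psi>
  assume a: "\<And>x a. x \<in> Obj C \<Longrightarrow> a \<in> fob X x \<Longrightarrow>
      \<phi> x a \<in> fob Y x \<and> \<psi> x (\<phi> x a) = a \<and> str Y x (\<phi> x a) = str X x a"
    "\<And>x b. x \<in> Obj C \<Longrightarrow> b \<in> fob Y x \<Longrightarrow> \<psi> x b \<in> fob X x \<and> \<phi> x (\<psi> x b) = b"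
    "\<And>g a. g \<in> Arr C \<Longrightarrow> a \<in> fob X (Src C g) \<Longrightarrow>
      \<phi> (Tgt C g) (fmap X g a) = fmap Y g (\<phi> (Src C g) a)"
  have nat: "\<phi> x (fmap X g a) = fmap Y g (\<phi> x a)" if "g \<in> Hom C x x" "a \<in> fob X x" for g a
    using a(3)[of g a] that by (auto simp: Hom_def)
  show ?thesis
    by (rule crossed_slices.slice_isoI[OF crossed_slices_restrict[OF x]
          slice_obj_restrict[OF x X], where \<phi> = "\<lambda>_. \<phi> x" and \<psi> = "\<lambda>_. \<psi> x"])
      (simp_all add: restrict_slice_def one_object_isotropy_simps a(1,2)[OF x] nat)
qed

definition restrict_class :: "'o \<Rightarrow> ('o, 'm, nat, 's) slice set \<Rightarrow> (unit, 'm, nat, 's) slice set" where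
  "restrict_class x P =
    (\<Union>X\<in>P. iso_class (one_object (isotropy C x)) (restrict_gmonoid x S) (restrict_slice x X))"

lemma restrict_class_iso_class:
  assumes x: "x \<in> Obj C" and X: "slice_obj C S X"
  shows "restrict_class x (iso_class C S X)
    = iso_class (one_object (isotropy C x)) (restrict_gmonoid x S) (restrict_slice x X)"
  unfolding restrict_class_def
proof (rule iso_class_UN[OF X])
  fix Y :: "('o, 'm, nat, 's) slice" assume Y: "slice_obj C S Y" and XY: "slice_iso C X Y"
  show "iso_class (one_object (isotropy C x)) (restrict_gmonoid x S) (restrict_slice x Y)
    = iso_class (one_object (isotropy C x)) (restrict_gmonoid x S) (restrict_slice x X)"
    by (rule crossed_slices.iso_class_eqI[OF crossed_slices_restrict[OF x], symmetric])
      (simp_all add: slice_obj_restrict slice_iso_restrict x X Y XY)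
qed

lemma restrict_class_hom:
  assumes x: "x \<in> Obj C"
  shows "restrict_class x
      \<in> ring_hom (iso_semiring C S) (iso_semiring (one_object (isotropy C x)) (restrict_gmonoid x S))"
    and "restrict_class x \<zero>\<^bsub>iso_semiring C S\<^esub>
      = \<zero>\<^bsub>iso_semiring (one_object (isotropy C x)) (restrict_gmonoid x S)\<^esub>"
proof -
  interpret x: crossed_slices "one_object (isotropy C x)" "restrict_gmonoid x S"
    using x by (rule crossed_slices_restrict)
  note simps = iso_class_simps x.iso_class_simps restrict_class_iso_class[OF x]
    slice_obj_restrict[OF x] restrict_slice_simps
  show "restrict_class x
      \<in> ring_hom (iso_semiring C S) (iso_semiring (one_object (isotropy C x)) (restrict_gmonoid x S))"
    by (rule ring_hom_memI; (elim iso_semiringE)?; simp add: simps)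
  show "restrict_class x \<zero>\<^bsub>iso_semiring C S\<^esub>
      = \<zero>\<^bsub>iso_semiring (one_object (isotropy C x)) (restrict_gmonoid x S)\<^esub>"
    by (simp add: simps)
qed

end

section \<open>Gluing along a transversal\<close>

text \<open>
  A choice of an arrow \<open>t y\<close> to each object \<open>y\<close> from the representative \<open>r y\<close> of its component. Requiring
  \<open>t\<close> to be the identity on \<open>R\<close> makes the retraction below fix the isotropy groups at \<open>R\<close>, so that an
  extended object restricts to the object it was built from without a further twist.
\<close>

locale transversal = groupoid C for C :: "('o, 'm) cat" +
  fixes R :: "'o set" and r :: "'o \<Rightarrow> 'o" and t :: "'o \<Rightarrow> 'm"
  assumes R_Obj: "R \<subseteq> Obj C"
    and r_R: "y \<in> Obj C \<Longrightarrow> r y \<in> R"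
    and t_Hom: "y \<in> Obj C \<Longrightarrow> t y \<in> Hom C (r y) y"
    and r_connected: "g \<in> Arr C \<Longrightarrow> r (Tgt C g) = r (Src C g)"
    and r_fixed: "x \<in> R \<Longrightarrow> r x = x"
    and t_fixed: "x \<in> R \<Longrightarrow> t x = Idt C x"
begin

lemma t_simps:
  assumes "y \<in> Obj C"
  shows "t y \<in> Arr C" "Src C (t y) = r y" "Tgt C (t y) = y" "r y \<in> Obj C"
  using t_Hom[OF assms] r_R[OF assms] R_Obj by (auto simp: Hom_def)

text \<open>
  The arrow part of the functor that retracts the groupoid onto the isotropy groups at \<open>R\<close>; on objects
  it is \<open>r\<close>.
\<close>

definition retract :: "'m \<Rightarrow> 'm" where
  "retract g = Cmp C (arr_inv C (t (Tgt C g))) (Cmp C g (t (Src C g)))"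

lemma retract_simps:
  assumes "g \<in> Arr C"
  shows "retract g \<in> Arr C" "Src C (retract g) = r (Src C g)" "Tgt C (retract g) = r (Src C g)"
  using assms by (simp_all add: retract_def groupoid_simps t_simps r_connected)

text \<open>
  The arrows \<open>t y\<close> form a natural isomorphism from the retraction to the identity functor; the second
  equation is naturality of its inverse.
\<close>

lemma t_retract:
  assumes "g \<in> Arr C"
  shows "Cmp C (t (Tgt C g)) (retract g) = Cmp C g (t (Src C g))"
    and "Cmp C (retract g) (arr_inv C (t (Src C g))) = Cmp C (arr_inv C (t (Tgt C g))) g"
  using assms by (simp_all add: retract_def groupoid_simps t_simps r_connected)

lemma retract_Idt: "y \<in> Obj C \<Longrightarrow> retract (Idt C y) = Idt C (r y)"
  by (simp add: retract_def groupoid_simps t_simps)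

lemma retract_Cmp:
  assumes "g \<in> Arr C" "h \<in> Arr C" "Src C g = Tgt C h"
  shows "retract (Cmp C g h) = Cmp C (retract g) (retract h)"
  using assms by (simp add: retract_def groupoid_simps t_simps r_connected)

lemma retract_fixed: "x \<in> R \<Longrightarrow> g \<in> Hom C x x \<Longrightarrow> retract g = g"
  using R_Obj by (auto simp: retract_def t_fixed Hom_def groupoid_simps arr_inv_Idt)

end

locale transversal_slices = transversal C R r t + crossed_slices C S
  for C :: "('o, 'm) cat" and R r t and S :: "('o, 'm, 's) gmonoid"
begin

text \<open>
  The bijection between the fibres of \<open>X\<close> over \<open>r y\<close> and \<open>y\<close> given by \<open>t y\<close>.
\<close>

lemma transport_t:
  assumes X: "slice_obj C S X" and y: "y \<in> Obj C"
  shows "a \<in> fob X (r y) \<Longrightarrow> fmap X (t y) a \<in> fob X y"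
    and "a \<in> fob X y \<Longrightarrow> fmap X (arr_inv C (t y)) a \<in> fob X (r y)"
    and "a \<in> fob X (r y) \<Longrightarrow> fmap X (arr_inv C (t y)) (fmap X (t y) a) = a"
    and "a \<in> fob X y \<Longrightarrow> fmap X (t y) (fmap X (arr_inv C (t y)) a) = a"
    and "a \<in> fob X (r y) \<Longrightarrow> str X y (fmap X (t y) a) = mmap S (t y) (str X (r y) a)"
  using slice_objD(2)[OF X, of "t y" a] slice_objD(2)[OF X, of "arr_inv C (t y)" a]
    slice_objD(4)[OF X, of "arr_inv C (t y)" "t y" a]
    slice_objD(4)[OF X, of "t y" "arr_inv C (t y)" a]
    slice_objD(6)[OF X, of "t y" a] slice_objD(3)[OF X]
  by (simp_all add: y groupoid_simps t_simps)

lemma transport_retract: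
  assumes X: "slice_obj C S X" and g: "g \<in> Arr C"
  shows "a \<in> fob X (r (Src C g)) \<Longrightarrow>
      fmap X (t (Tgt C g)) (fmap X (retract g) a) = fmap X g (fmap X (t (Src C g)) a)"
    and "b \<in> fob X (Src C g) \<Longrightarrow>
      fmap X (arr_inv C (t (Tgt C g))) (fmap X g b)
        = fmap X (retract g) (fmap X (arr_inv C (t (Src C g))) b)"
  using slice_objD(4)[OF X, of "t (Tgt C g)" "retract g" a] slice_objD(4)[OF X, of g "t (Src C g)" a]
    slice_objD(4)[OF X, of "arr_inv C (t (Tgt C g))" g b]
    slice_objD(4)[OF X, of "retract g" "arr_inv C (t (Src C g))" b]
  by (simp_all add: g t_retract groupoid_simps t_simps retract_simps r_connected)

text \<open>
  An isomorphism over \<open>y\<close> is forced by the one over \<open>r y\<close> through naturality with respect to \<open>t y\<close>. The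
  resulting family is natural with respect to \<open>g\<close> because transport turns \<open>g\<close> into an automorphism of
  the representative, for which naturality is given.
\<close>

lemma slice_iso_if_restrict:
  fixes X :: "('o, 'm, 'a, 's) slice" and Y :: "('o, 'm, 'b, 's) slice"
  assumes X: "slice_obj C S X" and Y: "slice_obj C S Y"
    and iso: "\<And>x. x \<in> R \<Longrightarrow>
      slice_iso (one_object (isotropy C x)) (restrict_slice x X) (restrict_slice x Y)"
  shows "slice_iso C X Y"
proof -
  \<comment> \<open>One predicate for the data over \<open>x\<close>, so that they can be chosen for all \<open>x\<close> at once.\<close>
  define iso_at where "iso_at x \<phi> \<psi> \<longleftrightarrow>
      (\<forall>a\<in>fob X x. \<phi> a \<in> fob Y x \<and> \<psi> (\<phi> a) = a \<and> str Y x (\<phi> a) = str X x a) \<and>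
      (\<forall>b\<in>fob Y x. \<psi> b \<in> fob X x \<and> \<phi> (\<psi> b) = b) \<and>
      (\<forall>g\<in>Hom C x x. \<forall>a\<in>fob X x. \<phi> (fmap X g a) = fmap Y g (\<phi> a))"
    for x and \<phi> :: "'a \<Rightarrow> 'b" and \<psi> :: "'b \<Rightarrow> 'a"
  have "\<exists>\<phi> \<psi>. iso_at x \<phi> \<psi>" if x: "x \<in> R" for x
  proof (rule slice_isoE[OF iso[OF x]], unfold restrict_slice_def one_object_isotropy_simps, simp)
    fix \<phi> :: "unit \<Rightarrow> 'a \<Rightarrow> 'b" and \<psi> :: "unit \<Rightarrow> 'b \<Rightarrow> 'a"
    assume "\<And>a. a \<in> fob X x \<Longrightarrow> \<phi> () a \<in> fob Y x \<and> \<psi> () (\<phi> () a) = a \<and> str Y x (\<phi> () a) = str X x a"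
      "\<And>b. b \<in> fob Y x \<Longrightarrow> \<psi> () b \<in> fob X x \<and> \<phi> () (\<psi> () b) = b"
      "\<And>g a. g \<in> Hom C x x \<Longrightarrow> a \<in> fob X x \<Longrightarrow> \<phi> () (fmap X g a) = fmap Y g (\<phi> () a)"
    then have "iso_at x (\<phi> ()) (\<psi> ())" unfolding iso_at_def by blast
    then show "\<exists>\<phi> \<psi>. iso_at x \<phi> \<psi>" by blast
  qed
  then obtain \<phi> \<psi> where iso_at: "\<And>x. x \<in> R \<Longrightarrow> iso_at x (\<phi> x) (\<psi> x)"
    by metis
  have \<phi>: "\<phi> x a \<in> fob Y x" "\<psi> x (\<phi> x a) = a" "str Y x (\<phi> x a) = str X x a"
    if "x \<in> R" "a \<in> fob X x" for x a
    using iso_at[OF that(1)] that(2) by (auto simp: iso_at_def)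
  have \<psi>: "\<psi> x b \<in> fob X x" "\<phi> x (\<psi> x b) = b" if "x \<in> R" "b \<in> fob Y x" for x b
    using iso_at[OF that(1)] that(2) by (auto simp: iso_at_def)
  have nat: "\<phi> (r (Src C g)) (fmap X (retract g) a) = fmap Y (retract g) (\<phi> (r (Src C g)) a)"
    if "g \<in> Arr C" "a \<in> fob X (r (Src C g))" for g a
    using iso_at[OF r_R[OF Src_closed]] that retract_simps[OF that(1)]
    by (simp add: iso_at_def Hom_def)
  define \<Phi> where "\<Phi> y a = fmap Y (t y) (\<phi> (r y) (fmap X (arr_inv C (t y)) a))" for y a
  define \<Psi> where "\<Psi> y b = fmap X (t y) (\<psi> (r y) (fmap Y (arr_inv C (t y)) b))" for y b
  note X_t = transport_t[OF X] and Y_t = transport_t[OF Y]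
  show ?thesis
  proof (rule slice_isoI[OF X, where \<phi> = \<Phi> and \<psi> = \<Psi>])
    fix y a assume "y \<in> Obj C" "a \<in> fob X y"
    then show "\<Phi> y a \<in> fob Y y \<and> \<Psi> y (\<Phi> y a) = a \<and> str Y y (\<Phi> y a) = str X y a"
      by (simp add: \<Phi>_def \<Psi>_def X_t Y_t \<phi> r_R flip: X_t(5))
  next
    fix y b assume "y \<in> Obj C" "b \<in> fob Y y"
    then show "\<Psi> y b \<in> fob X y \<and> \<Phi> y (\<Psi> y b) = b"
      by (simp add: \<Phi>_def \<Psi>_def X_t Y_t \<psi> r_R)
  next
    fix g a assume g: "g \<in> Arr C" and a: "a \<in> fob X (Src C g)"
    let ?u = "fmap X (arr_inv C (t (Src C g))) a"
    have u: "?u \<in> fob X (r (Src C g))" using g a by (simp add: X_t Src_closed)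
    have "\<Phi> (Tgt C g) (fmap X g a)
        = fmap Y (t (Tgt C g)) (\<phi> (r (Src C g)) (fmap X (retract g) ?u))"
      using g a by (simp add: \<Phi>_def transport_retract(2)[OF X] r_connected)
    also have "\<dots> = fmap Y (t (Tgt C g)) (fmap Y (retract g) (\<phi> (r (Src C g)) ?u))"
      using g u by (simp add: nat)
    also have "\<dots> = fmap Y g (\<Phi> (Src C g) a)"
      using g u by (simp add: \<Phi>_def transport_retract(1)[OF Y] \<phi> r_R Src_closed)
    finally show "\<Phi> (Tgt C g) (fmap X g a) = fmap Y g (\<Phi> (Src C g) a)" .
  qed
qed

text \<open>
  The pullback of the family \<open>Z\<close> along the retraction. Its structure map would take values in the
  monoids at the representatives, and is corrected by \<open>S (t y)\<close>.
\<close>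

definition extend_slice :: "('o \<Rightarrow> (unit, 'm, 'a, 's) slice) \<Rightarrow> ('o, 'm, 'a, 's) slice" where
  "extend_slice Z = \<lparr>fob = \<lambda>y. fob (Z (r y)) (), fmap = \<lambda>g. fmap (Z (r (Src C g))) (retract g),
    str = \<lambda>y a. mmap S (t y) (str (Z (r y)) () a)\<rparr>"

lemma
  assumes Z: "\<And>x. x \<in> R \<Longrightarrow> slice_obj (one_object (isotropy C x)) (restrict_gmonoid x S) (Z x)"
  shows slice_obj_extend: "slice_obj C S (extend_slice Z)"
    and restrict_extend_iso: "x \<in> R \<Longrightarrow>
      slice_iso (one_object (isotropy C x)) (Z x) (restrict_slice x (extend_slice Z))"
proof -
  have Zx: "finite (fob (Z x) ())"
      "g \<in> Hom C x x \<Longrightarrow> a \<in> fob (Z x) () \<Longrightarrow> fmap (Z x) g a \<in> fob (Z x) ()"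
      "a \<in> fob (Z x) () \<Longrightarrow> fmap (Z x) (Idt C x) a = a"
      "g \<in> Hom C x x \<Longrightarrow> h \<in> Hom C x x \<Longrightarrow> a \<in> fob (Z x) () \<Longrightarrow>
        fmap (Z x) (Cmp C g h) a = fmap (Z x) g (fmap (Z x) h a)"
      "a \<in> fob (Z x) () \<Longrightarrow> str (Z x) () a \<in> carrier (mob S x)"
      "g \<in> Hom C x x \<Longrightarrow> a \<in> fob (Z x) () \<Longrightarrow>
        str (Z x) () (fmap (Z x) g a) = mmap S g (str (Z x) () a)"
    if x: "x \<in> R" for x g h a
  proof -
    have "x \<in> Obj C" using x R_Obj by blast
    then interpret x: crossed_slices "one_object (isotropy C x)" "restrict_gmonoid x S"
      by (rule crossed_slices_restrict)
    note D = x.slice_objD[OF Z[OF x], unfolded one_object_isotropy_simps restrict_gmonoid_def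
        gmonoid.simps, simplified]
    show "finite (fob (Z x) ())" by (rule D)
    show "g \<in> Hom C x x \<Longrightarrow> a \<in> fob (Z x) () \<Longrightarrow> fmap (Z x) g a \<in> fob (Z x) ()" by (rule D)
    show "a \<in> fob (Z x) () \<Longrightarrow> fmap (Z x) (Idt C x) a = a" by (rule D)
    show "g \<in> Hom C x x \<Longrightarrow> h \<in> Hom C x x \<Longrightarrow> a \<in> fob (Z x) () \<Longrightarrow>
        fmap (Z x) (Cmp C g h) a = fmap (Z x) g (fmap (Z x) h a)" by (rule D)
    show "a \<in> fob (Z x) () \<Longrightarrow> str (Z x) () a \<in> carrier (mob S x)" by (rule D)
    show "g \<in> Hom C x x \<Longrightarrow> a \<in> fob (Z x) () \<Longrightarrow>
        str (Z x) () (fmap (Z x) g a) = mmap S g (str (Z x) () a)" by (rule D)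
  qed
  have retract_Hom: "retract g \<in> Hom C (r (Src C g)) (r (Src C g))" if "g \<in> Arr C" for g
    using retract_simps[OF that] by (simp add: Hom_def)
  note Zr = Zx[OF r_R]
  \<comment> \<open>The correction by \<open>t\<close> makes the structure map natural, as \<open>t\<close> is natural.\<close>
  have str: "mmap S (t (Tgt C g)) (mmap S (retract g) s) = mmap S g (mmap S (t (Src C g)) s)"
    if g: "g \<in> Arr C" and s: "s \<in> carrier (mob S (r (Src C g)))" for g s
  proof -
    have "mmap S (t (Tgt C g)) (mmap S (retract g) s) = mmap S (Cmp C (t (Tgt C g)) (retract g)) s"
      using g s by (subst mmap_Cmp) (simp_all add: t_simps retract_simps groupoid_simps r_connected)
    also have "\<dots> = mmap S (Cmp C g (t (Src C g))) s"
      using g by (simp add: t_retract)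
    also have "\<dots> = mmap S g (mmap S (t (Src C g)) s)"
      using g s by (subst mmap_Cmp) (simp_all add: t_simps groupoid_simps)
    finally show ?thesis .
  qed
  have t_closed: "mmap S (t y) s \<in> carrier (mob S y)"
    if "y \<in> Obj C" "s \<in> carrier (mob S (r y))" for y s
    using mmap_closed[of "t y" s] that by (simp add: t_simps)
  show ext: "slice_obj C S (extend_slice Z)"
    unfolding slice_obj_iff extend_slice_def gset.simps slice.simps
  proof (intro conjI ballI impI)
    fix g h a assume gh: "g \<in> Arr C" "h \<in> Arr C" "Src C g = Tgt C h"
      and a: "a \<in> fob (Z (r (Src C h))) ()"
    show "fmap (Z (r (Src C (Cmp C g h)))) (retract (Cmp C g h)) a
      = fmap (Z (r (Src C g))) (retract g) (fmap (Z (r (Src C h))) (retract h) a)"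
      using gh a retract_Hom[of g] retract_Hom[of h]
      by (simp add: arr_simps r_connected retract_Cmp Zr)
  qed (simp_all add: Zr retract_Hom r_connected arr_simps t_simps retract_Idt str t_closed)
  show "slice_iso (one_object (isotropy C x)) (Z x) (restrict_slice x (extend_slice Z))" if x: "x \<in> R"
  proof -
    have Obj: "x \<in> Obj C" using x R_Obj by blast
    interpret x: crossed_slices "one_object (isotropy C x)" "restrict_gmonoid x S"
      using Obj by (rule crossed_slices_restrict)
    show ?thesis
    proof (rule x.slice_isoI[OF Z[OF x], where \<phi> = "\<lambda>_ a. a" and \<psi> = "\<lambda>_ a. a"])
      fix g a assume "g \<in> Arr (one_object (isotropy C x))"
      then have g: "g \<in> Hom C x x" by (simp add: one_object_isotropy_simps)
      then have "Src C g = x" by (simp add: Hom_def)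
      then show "fmap (Z x) g a = fmap (restrict_slice x (extend_slice Z)) g a"
        by (simp add: restrict_slice_def extend_slice_def r_fixed x retract_fixed[OF x g])
    qed (simp_all add: restrict_slice_def extend_slice_def r_fixed t_fixed x mmap_Idt Obj Zx
        one_object_isotropy_simps)
  qed
qed

text \<open>
  The lemmas \<open>slice_iso_if_restrict\<close> and \<open>restrict_extend_iso\<close> are joint injectivity and joint
  surjectivity of the restrictions on isomorphism classes.
\<close>

theorem crossed_burnside_over_iso:
  "crossed_burnside_over C S \<simeq>
    product_ring R (\<lambda>x. crossed_burnside_over (one_object (isotropy C x)) (restrict_gmonoid x S))"
  unfolding crossed_burnside_over_def
proof (rule groth_product_iso[where f = restrict_class])
  show "semiring (iso_semiring C S)" by (rule semiring_iso_semiring)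
  fix x assume "x \<in> R"
  then have x: "x \<in> Obj C" using R_Obj by blast
  then show "semiring (iso_semiring (one_object (isotropy C x)) (restrict_gmonoid x S))"
    by (intro crossed_slices.semiring_iso_semiring crossed_slices_restrict)
  show "restrict_class x
      \<in> ring_hom (iso_semiring C S) (iso_semiring (one_object (isotropy C x)) (restrict_gmonoid x S))"
    "restrict_class x \<zero>\<^bsub>iso_semiring C S\<^esub>
      = \<zero>\<^bsub>iso_semiring (one_object (isotropy C x)) (restrict_gmonoid x S)\<^esub>"
    using x by (rule restrict_class_hom)+
next
  fix P Q assume P: "P \<in> carrier (iso_semiring C S)" and Q: "Q \<in> carrier (iso_semiring C S)"
    and eq: "\<forall>x\<in>R. restrict_class x P = restrict_class x Q"
  obtain X :: "('o, 'm, nat, 's) slice" where X: "slice_obj C S X" "P = iso_class C S X"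
    using P by (rule iso_semiringE)
  obtain Y :: "('o, 'm, nat, 's) slice" where Y: "slice_obj C S Y" "Q = iso_class C S Y"
    using Q by (rule iso_semiringE)
  have "slice_iso C X Y"
  proof (rule slice_iso_if_restrict[OF X(1) Y(1)])
    fix x assume x: "x \<in> R"
    then have Obj: "x \<in> Obj C" using R_Obj by blast
    have "restrict_class x P = restrict_class x Q" using eq x by blast
    then have "iso_class (one_object (isotropy C x)) (restrict_gmonoid x S) (restrict_slice x X)
        = iso_class (one_object (isotropy C x)) (restrict_gmonoid x S) (restrict_slice x Y)"
      by (simp add: X Y restrict_class_iso_class[OF Obj])
    then show "slice_iso (one_object (isotropy C x)) (restrict_slice x X) (restrict_slice x Y)"
      using crossed_slices.iso_class_eq_iff[OF crossed_slices_restrict[OF Obj]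
          slice_obj_restrict[OF Obj X(1)] slice_obj_restrict[OF Obj Y(1)]] by simp
  qed
  then show "P = Q" using X Y by (simp add: iso_class_eq_iff)
next
  fix p assume p: "\<forall>x\<in>R. p x
    \<in> carrier (iso_semiring (one_object (isotropy C x)) (restrict_gmonoid x S))"
  have "\<exists>Z :: (unit, 'm, nat, 's) slice.
      slice_obj (one_object (isotropy C x)) (restrict_gmonoid x S) Z \<and>
      p x = iso_class (one_object (isotropy C x)) (restrict_gmonoid x S) Z" if "x \<in> R" for x
    using p that by (auto simp: iso_semiring_def)
  then obtain Z :: "'o \<Rightarrow> (unit, 'm, nat, 's) slice" where
    Z: "\<And>x. x \<in> R \<Longrightarrow> slice_obj (one_object (isotropy C x)) (restrict_gmonoid x S) (Z x)"
    and pZ: "\<And>x. x \<in> R \<Longrightarrow> p x = iso_class (one_object (isotropy C x)) (restrict_gmonoid x S) (Z x)"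
    by metis
  have ext: "slice_obj C S (extend_slice Z)" by (rule slice_obj_extend) (rule Z)
  have "restrict_class x (iso_class C S (extend_slice Z)) = p x" if x: "x \<in> R" for x
  proof -
    have Obj: "x \<in> Obj C" using x R_Obj by blast
    interpret x: crossed_slices "one_object (isotropy C x)" "restrict_gmonoid x S"
      using Obj by (rule crossed_slices_restrict)
    show ?thesis
      unfolding restrict_class_iso_class[OF Obj ext] pZ[OF x]
      by (rule x.iso_class_eqI[symmetric])
        (simp_all add: Z x slice_obj_restrict[OF Obj ext] restrict_extend_iso)
  qed
  then show "\<exists>P\<in>carrier (iso_semiring C S). \<forall>x\<in>R. restrict_class x P = p x"
    using iso_class_closed[OF ext] by blast
qed

end

section \<open>Crossed Burnside rings of groupoids\<close>

text \<open>
  The representative of \<open>y\<close> is the unique object of \<open>R\<close> with an arrow to \<open>y\<close>; connected objects share it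
  because arrows compose.
\<close>

lemma (in groupoid) ex_transversal:
  assumes R: "R \<subseteq> Obj C" and unique: "\<forall>K\<in>components C. \<exists>!x. x \<in> R \<inter> K"
  obtains r t where "transversal C R r t"
proof -
  have ex1: "\<exists>!x. x \<in> R \<and> Hom C x y \<noteq> {}" if y: "y \<in> Obj C" for y
  proof -
    have "connected_rel C `` {y} \<in> components C"
      using y by (auto simp: components_def intro: quotientI)
    then have "\<exists>!x. x \<in> R \<inter> connected_rel C `` {y}" using unique by blast
    moreover have "x \<in> R \<inter> connected_rel C `` {y} \<longleftrightarrow> x \<in> R \<and> Hom C x y \<noteq> {}" for x
      using y R arr_inv(1) by (auto simp: connected_rel_def) blast+
    ultimately show ?thesis by simp
  qed
  define r where "r y = (THE x. x \<in> R \<and> Hom C x y \<noteq> {})" for y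
  have r: "r y \<in> R" "Hom C (r y) y \<noteq> {}" if "y \<in> Obj C" for y
    using theI'[OF ex1[OF that]] by (auto simp: r_def)
  have r_eq: "r y = x" if "y \<in> Obj C" "x \<in> R" "g \<in> Hom C x y" for x y g
    using the1_equality[OF ex1[OF that(1)], of x] that(2,3) by (auto simp: r_def)
  define t where "t y = (if y \<in> R then Idt C y else SOME g. g \<in> Hom C (r y) y)" for y
  have r_fixed: "r x = x" if "x \<in> R" for x
    using r_eq[of x x "Idt C x"] that R Idt_closed by auto
  have "transversal C R r t"
  proof
    show "t y \<in> Hom C (r y) y" if "y \<in> Obj C" for y
      using r(2)[OF that] that by (auto simp: t_def r_fixed Idt_closed some_in_eq)
    show "r (Tgt C g) = r (Src C g)" if g: "g \<in> Arr C" for g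
    proof -
      have Obj: "Src C g \<in> Obj C" "Tgt C g \<in> Obj C" using g by (simp_all add: arr_simps)
      obtain h where "h \<in> Hom C (r (Src C g)) (Src C g)" using r(2)[OF Obj(1)] by blast
      moreover have "g \<in> Hom C (Src C g) (Tgt C g)" using g by (simp add: Hom_def)
      ultimately show ?thesis using r_eq[OF Obj(2) r(1)[OF Obj(1)]] Cmp_closed by blast
    qed
  qed (use R r(1) r_fixed in \<open>simp_all add: t_def\<close>)
  then show thesis by (rule that)
qed

text \<open>
  The maps of a monoid-valued functor are total functions, and only their values on arrows and on
  elements of the monoids affect the slice objects.
\<close>

lemma iso_semiring_cong:
  assumes C: "category C" and mob: "mob S' = mob S"
    and mmap: "\<And>g s. g \<in> Arr C \<Longrightarrow> s \<in> carrier (mob S (Src C g)) \<Longrightarrow> mmap S' g s = mmap S g s"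
  shows "iso_semiring C S' = iso_semiring C S"
proof -
  have "slice_obj C S' X = slice_obj C S X" for X :: "('a, 'b, nat, 'c) slice"
    using category.Src_closed[OF C]
    by (auto simp: slice_obj_def gmaps_def underlying_def mob mmap Pi_iff)
  then show ?thesis
    by (simp add: iso_semiring_def iso_class_def slice_tensor_def slice_unit_def mob)
qed

text \<open>
  The two conjugation actions are not equal as records: inverses are computed in different categories and
  need not agree outside the isotropy group at \<open>x\<close>. On its arrows they do.
\<close>

lemma (in groupoid) iso_semiring_conj_isotropy:
  assumes "x \<in> Obj C"
  shows "iso_semiring (one_object (isotropy C x)) (conj_action (one_object (isotropy C x)))
    = iso_semiring (one_object (isotropy C x)) (restrict_gmonoid x (conj_action C))"
proof (rule iso_semiring_cong[OF category_isotropy[OF assms]])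
  have "isotropy (one_object (isotropy C x)) u = isotropy C x" for u
    by (simp add: isotropy_def one_object_isotropy_simps[unfolded isotropy_def])
  then show "mob (conj_action (one_object (isotropy C x)))
      = mob (restrict_gmonoid x (conj_action C))"
    by (simp add: conj_action_def restrict_gmonoid_def fun_eq_iff)
  fix g s assume "g \<in> Arr (one_object (isotropy C x))"
  then have "g \<in> Hom C x x" by (simp add: one_object_isotropy_simps)
  then have "is_inverse (one_object (isotropy C x)) g = is_inverse C g"
    by (auto simp: is_inverse_def one_object_isotropy_simps fun_eq_iff Hom_def)
  then show "mmap (conj_action (one_object (isotropy C x))) g s
      = mmap (restrict_gmonoid x (conj_action C)) g s"
    by (simp add: conj_action_def restrict_gmonoid_def arr_inv_def one_object_isotropy_simps)
qed

theorem theorem3p8: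
  fixes G :: "('o, 'm) cat" and R :: "'o set"
  assumes "finite_groupoid G"
    and "R \<subseteq> Obj G"
    and "\<forall>K\<in>components G. \<exists>!x. x \<in> R \<inter> K"
  shows "ring (crossed_burnside G) \<and>
    ring (product_ring R (\<lambda>x. crossed_burnside (one_object (isotropy G x)))) \<and>
    crossed_burnside G \<simeq> product_ring R (\<lambda>x. crossed_burnside (one_object (isotropy G x)))"
proof -
  interpret finite_groupoid G by (rule assms(1))
  obtain r t where "transversal G R r t"
    using assms(2,3) by (rule ex_transversal)
  then interpret transversal G R r t .
  interpret transversal_slices G R r t "conj_action G"
    by unfold_locales (rule gmonoid_conj_action)
  have isotropy: "crossed_burnside (one_object (isotropy G x))
      = crossed_burnside_over (one_object (isotropy G x)) (restrict_gmonoid x (conj_action G))"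
    if "x \<in> R" for x
    using iso_semiring_conj_isotropy[of x] that R_Obj
    by (auto simp: crossed_burnside_def crossed_burnside_over_def)
  have "ring (crossed_burnside G)"
    unfolding crossed_burnside_def by (rule ring_crossed_burnside_over)
  moreover have "ring (product_ring R (\<lambda>x. crossed_burnside (one_object (isotropy G x))))"
  proof (rule ring_product_ring)
    fix x assume x: "x \<in> R"
    then have "x \<in> Obj G" using R_Obj by blast
    then show "ring (crossed_burnside (one_object (isotropy G x)))"
      unfolding isotropy[OF x]
      by (intro crossed_slices.ring_crossed_burnside_over crossed_slices_restrict)
  qed
  moreover have "product_ring R (\<lambda>x. crossed_burnside (one_object (isotropy G x)))
      = product_ring R (\<lambda>x. crossed_burnside_over (one_object (isotropy G x))
          (restrict_gmonoid x (conj_action G)))"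
    by (auto simp: product_ring_def isotropy cong: PiE_cong restrict_cong)
  ultimately show ?thesis
    using crossed_burnside_over_iso by (simp add: crossed_burnside_def)
qed

end
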